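(* Let $1\le p<\infty$. The inclusion map $W^{1,p}\hookrightarrow L^p([0,1])$ is polynomial-time computable, where $W^{1,p}$ carries the representation $\xi_{1,p}$ and $L^p([0,1])$ carries $\xi_{0,p}$.
   Context: Framework. $\Sigma=\{0,1\}$, $|a|$ string length, $1^n$ unary string. Fix a bijective pairing $\langle\cdot,\cdot\rangle$ on $\Sigma^*$, polynomial-time computable with polynomial-time projections, monotone in both arguments (iterated for tuples), and an encoding $a\mapsto[\![a]\!]$ of dyadic rationals by strings (binary expansion allowing arbitrarily long codes). A string function $\varphi$ is length-monotone if $|a|\le|b|\Rightarrow|\varphi(a)|\le|\varphi(b)|$; its size is $|\varphi|(|a|):=|\varphi(a)|$. A second-order representation of $X$ is a partial surjection from length-monotone string functions onto $X$. Second-order polynomials: smallest class of $P:\mathbb{N}^{\mathbb{N}}\times\mathbb{N}\to\mathbb{N}$ containing $(l,n)\mapsto p(n)$ for integer polynomials $p$, closed under $+,\cdot$ and $P\mapsto((l,n)\mapsto l(P(l,n)))$. A map $f:X\to Y$ of represented spaces is polynomial-time computable if there are an oracle Turing machine $M$ and a second-order polynomial $P$ such that whenever $\varphi$ names $x$, $a\mapsto M^\varphi(a)$ names $f(x)$, and $M^\varphi(a)$ halts within $P(|\varphi|,|a|)$ steps. Weak derivative of $f\in L^1([0,1])$: $f'\in L^1$ with $\int fg'=-\int f'g$ for all $g\in C^\infty([0,1])$, $g(0)=g(1)=0$; $f^{(k)}$ is the $k$-fold iterate. $W^{m,p}$ is the set of $f\in L^p([0,1])$ with weak derivatives $f',\dots,f^{(m)}$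 existing in $L^p$. $\tilde g$ is $g$ extended by zero to $\mathbb{R}$, $(\tau_hg)(x)=g(x+h)$. An $L^p$-modulus of $g\in L^p([0,1])$ is $\mu:\mathbb{N}\to\mathbb{N}$ with $|h|\le2^{-\mu(n)}\Rightarrow\|\tilde g-\tau_h\tilde g\|_p<2^{-n}$ for all $n,h$, and $\mu(n)\ne0\Rightarrow\mu(n+1)>\mu(n)$. Representation $\xi_{m,p}$ of $W^{m,p}$: a length-monotone $\varphi$ names $f$ iff for all strings $a,b$ with $[\![a]\!],[\![b]\!]\in[0,1]$ and all $n$, $\left|\int_{[\![a]\!]}^{[\![b]\!]}f\,d\lambda-[\![\varphi(\langle a,b,1^n\rangle)]\!]\right|<2^{-n}$, and $|\varphi|$ is an $L^p$-modulus of $f^{(m)}$ (for $m=0$, of $f$; $W^{0,p}=L^p([0,1])$). *)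

theory Defs
  imports "HOL-Analysis.Analysis" "HOL-Computational_Algebra.Polynomial"
begin

section \<open>Strings and string functions\<close>

text \<open>The letters 0 and 1 are \<^term>\<open>False\<close> and \<^term>\<open>True\<close>.\<close>

type_synonym str = "bool list"
type_synonym strfun = "str \<Rightarrow> str"

definition ones :: "nat \<Rightarrow> str" where
  "ones n = replicate n True"

definition length_monotone :: "strfun \<Rightarrow> bool" where
  "length_monotone \<phi> \<longleftrightarrow> (\<forall>a b. length a \<le> length b \<longrightarrow> length (\<phi> a) \<le> length (\<phi> b))"

text \<open>For length-monotone \<^term>\<open>\<phi>\<close> the length of \<^term>\<open>\<phi> a\<close> depends only on the length
  of \<^term>\<open>a\<close>, so evaluating at \<^term>\<open>ones n\<close> is no restriction.\<close>

definition fun_size :: "strfun \<Rightarrow> nat \<Rightarrow> nat" where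
  "fun_size \<phi> n = length (\<phi> (ones n))"

text \<open>A code consists of a sign bit, a block \<open>1\<^sup>k0\<close>, and the digits of a binary expansion, of which
  the first \<open>k\<close> stand before the binary point (missing digits are zeros). Every string is a code,
  and appending zeros never changes the value.\<close>

fun dyadic :: "str \<Rightarrow> real" where
  "dyadic [] = 0"
| "dyadic (s # w) =
    (let k = length (takeWhile id w); d = drop (Suc k) w
     in (if s then - 1 else 1) * 2 ^ k * (\<Sum>i<length d. of_bool (d ! i) / 2 ^ Suc i))"

section \<open>Oracle Turing machines\<close>

text \<open>Deterministic multi-tape machines with two-way infinite tapes. States and tape symbols are
  initial segments of the natural numbers. Symbol 0 is the blank, symbols 1 and 2 are the letters
  0 and 1. State 0 is initial, state 1 is halting, state 2 is the query state, and state 3 is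
  entered after a query. Tape 0 is the input tape, tape 1 the output tape, tape 2 the query tape,
  tape 3 the answer tape; all others are work tapes.\<close>

datatype head_move = Move_Left | Stay | Move_Right

record machine =
  num_tapes :: nat
  num_states :: nat
  num_symbols :: nat
  trans :: "nat \<Rightarrow> nat list \<Rightarrow> nat \<times> (nat \<times> head_move) list"

definition wf_machine :: "machine \<Rightarrow> bool" where
  "wf_machine M \<longleftrightarrow> 4 \<le> num_tapes M \<and> 4 \<le> num_states M \<and> 3 \<le> num_symbols M \<and>
    (\<forall>q < num_states M. \<forall>ss. length ss = num_tapes M \<and> (\<forall>s\<in>set ss. s < num_symbols M) \<longrightarrow>
      (case trans M q ss of (q', acts) \<Rightarrow>
        q' < num_states M \<and> length acts = num_tapes M \<and> (\<forall>(s, m)\<in>set acts. s < num_symbols M)))"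

definition oracle_free :: "machine \<Rightarrow> bool" where
  "oracle_free M \<longleftrightarrow>
    (\<forall>q < num_states M. \<forall>ss. length ss = num_tapes M \<and> (\<forall>s\<in>set ss. s < num_symbols M) \<longrightarrow>
      fst (trans M q ss) \<noteq> 2)"

type_synonym tape = "int \<times> (int \<Rightarrow> nat)"  (* head position, contents *)
type_synonym config = "nat \<times> tape list"

definition blank_tape :: tape where
  "blank_tape = (0, \<lambda>_. 0)"

definition letter :: "bool \<Rightarrow> nat" where
  "letter b = (if b then 2 else 1)"

definition symbols_tape :: "nat list \<Rightarrow> tape" where
  "symbols_tape ss = (0, \<lambda>i. if 0 \<le> i \<and> nat i < length ss then ss ! nat i else 0)"

definition string_tape :: "str \<Rightarrow> tape" where
  "string_tape a = symbols_tape (map letter a)"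

text \<open>The string on a tape: the letters from cell 0 up to the first cell not holding a letter.\<close>

definition tape_string :: "tape \<Rightarrow> str" where
  "tape_string t =
    map (\<lambda>i. snd t (int i) = letter True) [0..<(LEAST n. snd t (int n) \<notin> range letter)]"

definition tape_read :: "tape \<Rightarrow> nat" where
  "tape_read t = snd t (fst t)"

fun tape_act :: "nat \<times> head_move \<Rightarrow> tape \<Rightarrow> tape" where
  "tape_act (s, m) (h, c) =
    (case m of Move_Left \<Rightarrow> h - 1 | Stay \<Rightarrow> h | Move_Right \<Rightarrow> h + 1, c(h := s))"

text \<open>A query takes one step: it erases the query tape and puts the oracle's answer on the
  answer tape, with both heads reset to cell 0.\<close>

fun step :: "machine \<Rightarrow> strfun \<Rightarrow> config \<Rightarrow> config" where
  "step M \<phi> (q, ts) =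
    (if q = 1 then (q, ts)
     else if q = 2 then (3, ts[2 := blank_tape, 3 := string_tape (\<phi> (tape_string (ts ! 2)))])
     else (case trans M q (map tape_read ts) of (q', acts) \<Rightarrow> (q', map2 tape_act acts ts)))"

text \<open>Several input strings are separated by single blanks on the input tape.\<close>

fun input_symbols :: "str list \<Rightarrow> nat list" where
  "input_symbols [] = []"
| "input_symbols [a] = map letter a"
| "input_symbols (a # as) = map letter a @ 0 # input_symbols as"

definition init_config :: "machine \<Rightarrow> str list \<Rightarrow> config" where
  "init_config M as = (0, symbols_tape (input_symbols as) # replicate (num_tapes M - 1) blank_tape)"

definition computes_within :: "machine \<Rightarrow> strfun \<Rightarrow> str list \<Rightarrow> str \<Rightarrow> nat \<Rightarrow> bool" where
  "computes_within M \<phi> as b t \<longleftrightarrow>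
    (\<exists>n\<le>t. case (step M \<phi> ^^ n) (init_config M as) of (q, ts) \<Rightarrow>
      q = 1 \<and> tape_string (ts ! 1) = b)"

section \<open>Pairing functions\<close>

text \<open>The oracle passed to an \<^const>\<open>oracle_free\<close> machine is irrelevant.\<close>

definition polytime_unary :: "(str \<Rightarrow> str) \<Rightarrow> bool" where
  "polytime_unary f \<longleftrightarrow> (\<exists>M (r :: nat poly). wf_machine M \<and> oracle_free M \<and>
    (\<forall>a. computes_within M (\<lambda>_. []) [a] (f a) (poly r (length a))))"

definition polytime_binary :: "(str \<Rightarrow> str \<Rightarrow> str) \<Rightarrow> bool" where
  "polytime_binary f \<longleftrightarrow> (\<exists>M (r :: nat poly). wf_machine M \<and> oracle_free M \<and>
    (\<forall>a b. computes_within M (\<lambda>_. []) [a, b] (f a b) (poly r (length a + length b))))"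

text \<open>Monotonicity refers to the length-lexicographic order, i.e. to the usual order of the natural
  numbers under their standard identification with binary strings; Cantor's pairing function is an
  instance. (No bijective pairing is monotone with respect to lengths alone: the number of pairs
  with image of length \<open>n\<close> would have to be a sum of terms \<open>2\<^bsup>i+j\<^esup>\<close> for the length pairs \<open>(i, j)\<close>
  mapped to \<open>n\<close>, and this fails for one of \<open>(0, 1)\<close> and \<open>(1, 0)\<close>.)\<close>

definition str_le :: "str \<Rightarrow> str \<Rightarrow> bool" where
  "str_le a b \<longleftrightarrow> a = b \<or> (a, b) \<in> lenlex {(False, True)}"

definition pairing_function :: "(str \<Rightarrow> str \<Rightarrow> str) \<Rightarrow> bool" where
  "pairing_function pr \<longleftrightarrow>
    bij (\<lambda>(a, b). pr a b) \<and>
    polytime_binary pr \<and>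
    polytime_unary (\<lambda>c. fst (inv (\<lambda>(a, b). pr a b) c)) \<and>
    polytime_unary (\<lambda>c. snd (inv (\<lambda>(a, b). pr a b) c)) \<and>
    (\<forall>a a' b. str_le a a' \<longrightarrow> str_le (pr a b) (pr a' b)) \<and>
    (\<forall>a b b'. str_le b b' \<longrightarrow> str_le (pr a b) (pr a b'))"

definition triple :: "(str \<Rightarrow> str \<Rightarrow> str) \<Rightarrow> str \<Rightarrow> str \<Rightarrow> str \<Rightarrow> str" where
  "triple pr a b c = pr a (pr b c)"

section \<open>Second-order polynomial time\<close>

inductive second_order_poly :: "((nat \<Rightarrow> nat) \<Rightarrow> nat \<Rightarrow> nat) \<Rightarrow> bool" where
  base: "(\<And>n :: nat. 0 \<le> poly r (int n)) \<Longrightarrow> second_order_poly (\<lambda>l n. nat (poly r (int n)))"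
| add: "second_order_poly P \<Longrightarrow> second_order_poly Q \<Longrightarrow> second_order_poly (\<lambda>l n. P l n + Q l n)"
| mult: "second_order_poly P \<Longrightarrow> second_order_poly Q \<Longrightarrow> second_order_poly (\<lambda>l n. P l n * Q l n)"
| app: "second_order_poly P \<Longrightarrow> second_order_poly (\<lambda>l n. l (P l n))"

text \<open>A representation is given by the relation ``\<open>\<phi>\<close> is a name of \<open>x\<close>''.\<close>

type_synonym 'x naming = "strfun \<Rightarrow> 'x \<Rightarrow> bool"

definition polytime_computable_map ::
  "'x set \<Rightarrow> 'x naming \<Rightarrow> 'y set \<Rightarrow> 'y naming \<Rightarrow> ('x \<Rightarrow> 'y) \<Rightarrow> bool" where
  "polytime_computable_map X \<delta> Y \<epsilon> f \<longleftrightarrow> (\<forall>x\<in>X. f x \<in> Y) \<and>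
    (\<exists>M P. wf_machine M \<and> second_order_poly P \<and>
      (\<forall>\<phi>. \<forall>x\<in>X. \<delta> \<phi> x \<longrightarrow>
        (\<exists>\<psi>. \<epsilon> \<psi> (f x) \<and>
          (\<forall>a. computes_within M \<phi> [a] (\<psi> a) (P (fun_size \<phi>) (length a))))))"

section \<open>Lebesgue and Sobolev spaces on the unit interval\<close>

definition Lp_funs :: "real \<Rightarrow> (real \<Rightarrow> real) set" where
  "Lp_funs p = {f. f \<in> borel_measurable (lebesgue_on {0..1}) \<and>
    integrable (lebesgue_on {0..1}) (\<lambda>x. \<bar>f x\<bar> powr p)}"

definition ae_eq :: "real \<Rightarrow> ((real \<Rightarrow> real) \<times> (real \<Rightarrow> real)) set" where
  "ae_eq p = {(f, g). f \<in> Lp_funs p \<and> g \<in> Lp_funs p \<and> (AE x in lebesgue_on {0..1}. f x = g x)}"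

definition Lp_space :: "real \<Rightarrow> (real \<Rightarrow> real) set set" where
  "Lp_space p = Lp_funs p // ae_eq p"

text \<open>\<open>D\<close> is the sequence of derivatives (one-sided at the end points) of a function in
  \<open>C\<^sup>\<infinity>([0,1])\<close> that vanishes at both end points.\<close>

definition test_function :: "(nat \<Rightarrow> real \<Rightarrow> real) \<Rightarrow> bool" where
  "test_function D \<longleftrightarrow>
    (\<forall>k. \<forall>x\<in>{0..1}. (D k has_real_derivative D (Suc k) x) (at x within {0..1})) \<and>
    D 0 0 = 0 \<and> D 0 1 = 0"

definition weak_derivative :: "(real \<Rightarrow> real) \<Rightarrow> (real \<Rightarrow> real) \<Rightarrow> bool" where
  "weak_derivative f f' \<longleftrightarrow> f \<in> Lp_funs 1 \<and> f' \<in> Lp_funs 1 \<and>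
    (\<forall>D. test_function D \<longrightarrow>
      (LINT x|lebesgue_on {0..1}. f x * D 1 x) = - (LINT x|lebesgue_on {0..1}. f' x * D 0 x))"

definition sobolev_space :: "nat \<Rightarrow> real \<Rightarrow> (real \<Rightarrow> real) set set" where
  "sobolev_space m p = {F \<in> Lp_space p. \<exists>f\<in>F. \<forall>k\<in>{1..m}. \<exists>g\<in>Lp_funs p. (weak_derivative ^^ k) f g}"

definition Lp_norm_line :: "real \<Rightarrow> (real \<Rightarrow> real) \<Rightarrow> real" where
  "Lp_norm_line p f = (LINT x|lebesgue. \<bar>f x\<bar> powr p) powr (1 / p)"

definition zero_extension :: "(real \<Rightarrow> real) \<Rightarrow> real \<Rightarrow> real" where
  "zero_extension g x = (if x \<in> {0..1} then g x else 0)"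

definition Lp_modulus :: "real \<Rightarrow> (real \<Rightarrow> real) \<Rightarrow> (nat \<Rightarrow> nat) \<Rightarrow> bool" where
  "Lp_modulus p g \<mu> \<longleftrightarrow> g \<in> Lp_funs p \<and>
    (\<forall>n h. \<bar>h\<bar> \<le> 1 / 2 ^ \<mu> n \<longrightarrow>
      Lp_norm_line p (\<lambda>x. zero_extension g x - zero_extension g (x + h)) < 1 / 2 ^ n) \<and>
    (\<forall>n. \<mu> n \<noteq> 0 \<longrightarrow> \<mu> n < \<mu> (Suc n))"

text \<open>The two conditions on the representative \<open>f\<close> are invariant under changes on null sets, and
  the \<open>m\<close>-fold weak derivative is unique up to null sets. The integral is the oriented one.\<close>

definition xi :: "(str \<Rightarrow> str \<Rightarrow> str) \<Rightarrow> nat \<Rightarrow> real \<Rightarrow> (real \<Rightarrow> real) set naming" where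
  "xi pr m p \<phi> F \<longleftrightarrow> F \<in> sobolev_space m p \<and> length_monotone \<phi> \<and>
    (\<exists>f\<in>F.
      (\<forall>a b n. dyadic a \<in> {0..1} \<and> dyadic b \<in> {0..1} \<longrightarrow>
        \<bar>(LINT x=ereal (dyadic a)..ereal (dyadic b)|lebesgue. f x)
          - dyadic (\<phi> (triple pr a b (ones n)))\<bar> < 1 / 2 ^ n) \<and>
      (\<exists>g. (weak_derivative ^^ m) f g \<and> Lp_modulus p g (fun_size \<phi>)))"

end

theory Submission
  imports Defs
begin

text \<open>
  A function \<open>f\<close> in \<open>W\<^bsup>1,p\<^esup>\<close> agrees almost everywhere with a primitive \<open>c + \<integral> g\<close> of its weak
  derivative \<open>g\<close>. A modulus \<open>\<mu>\<close> of \<open>g\<close> bounds \<open>\<parallel>g\<parallel>\<^sub>1\<close> by \<open>6 \<cdot> 2\<^bsup>\<mu>(0)\<^esup>\<close>, since the support of the zero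
  extension is left after \<open>2 \<cdot> 2\<^bsup>\<mu>(0)\<^esup>\<close> translations by \<open>2\<^bsup>-\<mu>(0)\<^esup>\<close>; together with one value of
  \<open>\<integral>f\<close> this bounds \<open>\<bar>f\<bar>\<close> by some \<open>B\<close>, exponential in the size of the name. The zero extension
  of \<open>f\<close> has total variation at most \<open>2 B + \<parallel>g\<parallel>\<^sub>1\<close>, so a translation by \<open>h\<close> moves it in \<open>L\<^sup>1\<close> by at
  most \<open>\<bar>h\<bar> (2 B + \<parallel>g\<parallel>\<^sub>1)\<close>, hence in \<open>L\<^sup>p\<close> by \<open>O(\<bar>h\<bar>\<^bsup>1/p\<^esup> B)\<close>. Therefore a linear function of \<open>n\<close>
  and the size of the name is an \<open>L\<^sup>p\<close>-modulus of \<open>f\<close>. The approximations of the integrals can be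
  kept, so all the machine does is to pad each answer with zeros to the required length.
\<close>

section \<open>Straight-line oracle machines\<close>

text \<open>\<open>Scan d s t f\<close> walks along tape \<open>s\<close> in direction
  \<open>d\<close> up to a blank and appends the images under \<open>f\<close> of the letters read
  to tape \<open>t\<close>; a constant \<open>f\<close> turns the length of a string into a block of
  zeros. The scan is the only loop.\<close>

datatype instr = Put nat bool | Scan head_move nat nat "bool \<Rightarrow> bool" | Query

fun reverse_move :: "head_move \<Rightarrow> head_move" where
  "reverse_move Move_Left = Move_Right"
| "reverse_move Stay = Stay"
| "reverse_move Move_Right = Move_Left"

definition idle :: "nat list \<Rightarrow> (nat \<times> head_move) list" where
  "idle ss = map (\<lambda>s. (s, Stay)) ss"

text \<open>State \<open>4 + i\<close> executes instruction \<open>i\<close>. As every query returns to state 3, the return address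
  is left as a symbol on tape 4. A scan stops at the first blank and then steps back, so that the
  same tape can next be scanned in the opposite direction.\<close>

definition instr_trans :: "instr \<Rightarrow> nat \<Rightarrow> nat list \<Rightarrow> nat \<times> (nat \<times> head_move) list" where
  "instr_trans c i ss = (case c of
     Put t b \<Rightarrow> (5 + i, (idle ss)[t := (letter b, Move_Right)])
   | Scan d s t f \<Rightarrow>
      (if ss ! s = 0 then (5 + i, (idle ss)[s := (0, reverse_move d)])
       else (4 + i, (idle ss)[s := (letter (ss ! s = letter True), d),
                              t := (letter (f (ss ! s = letter True)), Move_Right)]))
   | Query \<Rightarrow> (2, (idle ss)[4 := (Suc i, Stay)]))"

text \<open>State \<open>4 + length cs\<close>, the first one without an instruction, leads to the
  halting state. Return addresses \<open>Suc i\<close> may coincide with letters, tape 4 being kept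
  for them. State 3 jumps to \<open>4 + ss ! 4\<close> whatever the symbol is, hence there are 4
  more states than symbols.\<close>

definition compile :: "instr list \<Rightarrow> machine" where
  "compile cs = \<lparr>num_tapes = 5, num_states = 7 + length cs, num_symbols = 3 + length cs,
     trans = (\<lambda>q ss. if q = 0 then (4, idle ss)
                    else if q = 3 then (4 + ss ! 4, (idle ss)[4 := (0, Stay)])
                    else if 4 \<le> q \<and> q - 4 < length cs then instr_trans (cs ! (q - 4)) (q - 4) ss
                    else (1, idle ss))\<rparr>"

lemma letter_less_3: "letter b < 3 + n"
  by (simp add: letter_def)

lemma compile_sizes:
  "num_tapes (compile cs) = 5" "num_states (compile cs) = 7 + length cs"
  "num_symbols (compile cs) = 3 + length cs"
  by (simp_all add: compile_def)

lemma wf_machine_compile: "wf_machine (compile cs)"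
proof -
  have upd: "\<forall>x\<in>set (xs[i := (a, m)]). fst x < N"
    if "\<forall>x\<in>set xs. fst x < N" "a < N" for xs :: "(nat \<times> head_move) list" and i a m N
    using that set_update_subset_insert[of xs i "(a, m)"] by fastforce
  have "case trans (compile cs) q ss of (q', acts) \<Rightarrow>
        q' < 7 + length cs \<and> length acts = 5 \<and> (\<forall>x\<in>set acts. fst x < 3 + length cs)"
    if q: "q < 7 + length cs" and ss: "length ss = 5" "\<forall>s\<in>set ss. s < 3 + length cs" for q ss
  proof -
    have idle: "\<forall>x\<in>set (idle ss). fst x < 3 + length cs"
      using ss by (auto simp: idle_def)
    have len: "length (idle ss) = 5"
      using ss by (simp add: idle_def)
    have "ss ! 4 < 3 + length cs"
      using ss by simp
    moreover have "length (snd (instr_trans c i ss)) = 5 \<and>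
        (\<forall>x\<in>set (snd (instr_trans c i ss)). fst x < 3 + length cs) \<and>
        fst (instr_trans c i ss) < 7 + length cs" if "i < length cs" for c i
      unfolding instr_trans_def using that len
      by (cases c; simp only: instr.case split: if_split)
        (intro conjI impI; (simp add: letter_less_3; fail | (simp only: snd_conv, intro upd idle; simp add: letter_less_3)))+
    moreover have "\<forall>x\<in>set ((idle ss)[4 := (0, Stay)]). fst x < 3 + length cs"
      by (intro upd idle) simp
    ultimately show ?thesis
      using q len idle by (simp add: compile_def case_prod_beta) blast
  qed
  then show ?thesis
    unfolding wf_machine_def compile_sizes by (simp add: case_prod_beta) blast
qed

section \<open>Tapes holding a string\<close>

definition tape_on :: "str \<Rightarrow> int \<Rightarrow> tape" where
  "tape_on w h = (h, snd (string_tape w))"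

text \<open>The head stands on the first blank behind the string, where the next letter is
  appended.\<close>

abbreviation tape_end :: "str \<Rightarrow> tape" where
  "tape_end w \<equiv> tape_on w (int (length w))"

lemma letter_neq_0 [simp]: "letter b \<noteq> 0"
  by (simp add: letter_def)

lemma letter_eq_iff [simp]: "letter b = letter c \<longleftrightarrow> b = c"
  by (simp add: letter_def)

lemma snd_string_tape:
  "snd (string_tape w) i = (if 0 \<le> i \<and> nat i < length w then letter (w ! nat i) else 0)"
  by (simp add: string_tape_def symbols_tape_def)

lemma tape_string_tape_on [simp]: "tape_string (tape_on w h) = w"
proof -
  have "(LEAST n. snd (tape_on w h) (int n) \<notin> range letter) = length w"
  proof (rule Least_equality)
    show "snd (tape_on w h) (int (length w)) \<notin> range letter"
      by (auto simp: tape_on_def snd_string_tape dest: sym)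
  next
    fix n assume "snd (tape_on w h) (int n) \<notin> range letter"
    then show "length w \<le> n"
      by (cases "n < length w") (auto simp: tape_on_def snd_string_tape)
  qed
  then show ?thesis
    by (auto simp: tape_string_def tape_on_def snd_string_tape intro!: nth_equalityI)
qed

lemma string_tape_eq: "string_tape w = tape_on w 0"
  by (simp add: tape_on_def string_tape_def symbols_tape_def)

lemma blank_tape_eq: "blank_tape = tape_on [] 0"
  by (simp add: blank_tape_def tape_on_def string_tape_def symbols_tape_def)

lemma tape_read_tape_on [simp]:
  "tape_read (tape_on w h) = (if 0 \<le> h \<and> nat h < length w then letter (w ! nat h) else 0)"
  by (simp add: tape_read_def tape_on_def snd_string_tape)

lemma tape_act_append: "tape_act (letter b, Move_Right) (tape_end w) = tape_end (w @ [b])"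
  by (auto simp: tape_on_def fun_eq_iff snd_string_tape nth_append)

lemma tape_act_tape_read:
  "tape_act (tape_read (tape_on w h), m) (tape_on w h)
     = tape_on w (case m of Move_Left \<Rightarrow> h - 1 | Stay \<Rightarrow> h | Move_Right \<Rightarrow> h + 1)"
  by (simp add: tape_on_def tape_read_def split: head_move.split)

text \<open>Writing back what was read changes nothing, so an instruction affects only the tapes at
  which it updates \<open>idle\<close>.\<close>

lemma map2_tape_act_idle: "map2 tape_act (idle (map tape_read ts)) ts = ts"
proof -
  have "tape_act (tape_read t, Stay) t = t" for t :: tape
    by (cases t) (simp add: tape_read_def)
  from this[of "ts ! _"] show ?thesis
    by (intro nth_equalityI) (simp_all add: idle_def)
qed

lemma map2_tape_act_update:
  assumes "length acts = length ts" "s < length ts"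
  shows "map2 tape_act (acts[s := x]) ts = (map2 tape_act acts ts)[s := tape_act x (ts ! s)]"
  using assms by (auto intro!: nth_equalityI simp: nth_list_update)

section \<open>Runs of compiled machines with exact step counts\<close>

definition reaches :: "machine \<Rightarrow> strfun \<Rightarrow> nat \<Rightarrow> config \<Rightarrow> config \<Rightarrow> bool" where
  "reaches M \<phi> t c c' \<longleftrightarrow> (step M \<phi> ^^ t) c = c'"

lemma reaches_0: "reaches M \<phi> 0 c c"
  by (simp add: reaches_def)

lemma reaches_step: "reaches M \<phi> 1 c (step M \<phi> c)"
  by (simp add: reaches_def)

lemma reaches_trans:
  assumes "reaches M \<phi> t c c'" "reaches M \<phi> u c' c''"
  shows "reaches M \<phi> (t + u) c c''"
  using assms by (simp add: reaches_def funpow_add add.commute[of t u])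

lemma length_idle [simp]: "length (idle ss) = length ss"
  by (simp add: idle_def)

lemma step_instr:
  assumes "i < length cs"
  shows "step (compile cs) \<phi> (4 + i, ts) =
    (case instr_trans (cs ! i) i (map tape_read ts) of (q, acts) \<Rightarrow> (q, map2 tape_act acts ts))"
  using assms by (simp add: compile_def)

lemma reaches_Put:
  assumes "i < length cs" "cs ! i = Put t b" "t < length ts" "ts ! t = tape_end w"
  shows "reaches (compile cs) \<phi> 1 (4 + i, ts) (5 + i, ts[t := tape_end (w @ [b])])"
  using assms reaches_step[of "compile cs" \<phi> "(4 + i, ts)"]
  by (simp add: step_instr instr_trans_def map2_tape_act_update map2_tape_act_idle tape_act_append
      del: tape_act.simps step.simps)

lemma step_Scan_letter:
  assumes "i < length cs" "cs ! i = Scan d s t f" "s \<noteq> t" "s < length ts" "t < length ts"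
    and "ts ! s = tape_on w (int j)" "j < length w" "ts ! t = tape_end v"
  shows "step (compile cs) \<phi> (4 + i, ts) = (4 + i,
    ts[s := tape_on w (case d of Move_Left \<Rightarrow> int j - 1 | Stay \<Rightarrow> int j | Move_Right \<Rightarrow> int j + 1),
       t := tape_end (v @ [f (w ! j)])])"
proof -
  have "tape_act (letter (w ! j), d) (tape_on w (int j))
     = tape_on w (case d of Move_Left \<Rightarrow> int j - 1 | Stay \<Rightarrow> int j | Move_Right \<Rightarrow> int j + 1)"
    using tape_act_tape_read[of w "int j" d] assms by simp
  then show ?thesis
    using assms
    by (simp add: step_instr instr_trans_def map2_tape_act_update map2_tape_act_idle tape_act_append
        del: tape_act.simps step.simps)
qed

lemma step_Scan_blank:
  assumes "i < length cs" "cs ! i = Scan d s t f" "s < length ts"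
    and "ts ! s = tape_on w h" "\<not> (0 \<le> h \<and> nat h < length w)"
  shows "step (compile cs) \<phi> (4 + i, ts) = (5 + i,
    ts[s := tape_on w (case reverse_move d of Move_Left \<Rightarrow> h - 1 | Stay \<Rightarrow> h | Move_Right \<Rightarrow> h + 1)])"
proof -
  have "tape_act (0, reverse_move d) (tape_on w h)
     = tape_on w (case reverse_move d of Move_Left \<Rightarrow> h - 1 | Stay \<Rightarrow> h | Move_Right \<Rightarrow> h + 1)"
    using tape_act_tape_read[of w h "reverse_move d"] assms by simp
  then show ?thesis
    using assms
    by (simp add: step_instr instr_trans_def map2_tape_act_update map2_tape_act_idle
        del: tape_act.simps step.simps)
qed

text \<open>Induction on the number of letters still to be read. The extra step is the one on the
  blank, which brings the head back to the last letter. For the empty string the head comes to rest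
  in cell -1, again a blank, which is where a scan to the left expects it.\<close>

lemma reaches_Scan_right_from:
  assumes "i < length cs" "cs ! i = Scan Move_Right s t f" "s \<noteq> t" "s < length ts" "t < length ts"
    and "ts ! s = tape_on w (int j)" "j \<le> length w" "ts ! t = tape_end v"
  shows "reaches (compile cs) \<phi> (length w - j + 1) (4 + i, ts)
    (5 + i, ts[s := tape_on w (int (length w) - 1), t := tape_end (v @ map f (drop j w))])"
  using assms(4-)
proof (induction "length w - j" arbitrary: j v ts)
  case 0
  then have "j = length w" by simp
  with 0 have "ts[t := tape_end v] = ts" by (metis list_update_id)
  then show ?case
    using 0 \<open>j = length w\<close> assms(1-3) step_Scan_blank[of i cs Move_Right s t f ts w "int j" \<phi>]
      reaches_step[of "compile cs" \<phi> "(4 + i, ts)"] list_update_swap[OF assms(3), of ts]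
    by (simp del: step.simps)
next
  case (Suc n)
  then have j: "j < length w" by simp
  define ts' where "ts' = ts[s := tape_on w (int j + 1), t := tape_end (v @ [f (w ! j)])]"
  have "step (compile cs) \<phi> (4 + i, ts) = (4 + i, ts')"
    using step_Scan_letter[OF assms(1-3) Suc.prems(1-3) j Suc.prems(5)] by (simp add: ts'_def)
  then have 1: "reaches (compile cs) \<phi> 1 (4 + i, ts) (4 + i, ts')"
    using reaches_step by metis
  have 2: "reaches (compile cs) \<phi> (length w - Suc j + 1) (4 + i, ts')
    (5 + i, ts'[s := tape_on w (int (length w) - 1),
       t := tape_end ((v @ [f (w ! j)]) @ map f (drop (Suc j) w))])"
    using Suc.prems Suc.hyps(2) j assms(3) by (intro Suc.hyps(1)) (auto simp: ts'_def add.commute)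
  have "(v @ [f (w ! j)]) @ map f (drop (Suc j) w) = v @ map f (drop j w)"
    using j by (simp add: Cons_nth_drop_Suc[symmetric])
  moreover have "1 + (length w - Suc j + 1) = length w - j + 1"
    using j by simp
  moreover have "ts'[s := x, t := y] = ts[s := x, t := y]" for x y
    using assms(3) by (simp add: ts'_def list_update_swap)
  ultimately show ?case
    using reaches_trans[OF 1 2] by simp
qed

text \<open>The head stands on letter \<open>j - 1\<close>, so the first \<open>j\<close> letters
  are appended in reverse order; the blank in cell -1 sends the head to cell 0.\<close>

lemma reaches_Scan_left_from:
  assumes "i < length cs" "cs ! i = Scan Move_Left s t f" "s \<noteq> t" "s < length ts" "t < length ts"
    and "ts ! s = tape_on w (int j - 1)" "j \<le> length w" "ts ! t = tape_end v"
  shows "reaches (compile cs) \<phi> (j + 1) (4 + i, ts)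
    (5 + i, ts[s := tape_on w 0, t := tape_end (v @ map f (rev (take j w)))])"
  using assms(4-)
proof (induction j arbitrary: v ts)
  case 0
  then have "ts[t := tape_end v] = ts" by (metis list_update_id)
  then show ?case
    using 0 assms(1-3) step_Scan_blank[of i cs Move_Left s t f ts w "-1" \<phi>]
      reaches_step[of "compile cs" \<phi> "(4 + i, ts)"] list_update_swap[OF assms(3), of ts]
    by (simp del: step.simps)
next
  case (Suc j)
  define ts' where "ts' = ts[s := tape_on w (int j - 1), t := tape_end (v @ [f (w ! j)])]"
  have j: "j < length w" and s: "ts ! s = tape_on w (int j)"
    using Suc.prems by simp_all
  have "step (compile cs) \<phi> (4 + i, ts) = (4 + i, ts')"
    using step_Scan_letter[OF assms(1-3) Suc.prems(1-2) s j Suc.prems(5)] by (simp add: ts'_def)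
  then have 1: "reaches (compile cs) \<phi> 1 (4 + i, ts) (4 + i, ts')"
    using reaches_step by metis
  have 2: "reaches (compile cs) \<phi> (j + 1) (4 + i, ts')
    (5 + i, ts'[s := tape_on w 0, t := tape_end ((v @ [f (w ! j)]) @ map f (rev (take j w)))])"
    using Suc.prems j assms(3) by (intro Suc.IH) (auto simp: ts'_def)
  have "(v @ [f (w ! j)]) @ map f (rev (take j w)) = v @ map f (rev (take (Suc j) w))"
    using j by (simp add: take_Suc_conv_app_nth)
  moreover have "ts'[s := x, t := y] = ts[s := x, t := y]" for x y
    using assms(3) by (simp add: ts'_def list_update_swap)
  ultimately show ?case
    using reaches_trans[OF 1 2] by simp
qed


text \<open>States are numbered by positions in the whole program, so the code around
  \<open>cs\<close> is left arbitrary; this lets runs be composed by concatenating instruction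
  lists.\<close>

definition runs :: "strfun \<Rightarrow> instr list \<Rightarrow> nat \<Rightarrow> tape list \<Rightarrow> tape list \<Rightarrow> bool" where
  "runs \<phi> cs n ts ts' \<longleftrightarrow> (\<forall>as bs. reaches (compile (as @ cs @ bs)) \<phi> n
     (4 + length as, ts) (4 + length as + length cs, ts'))"

lemma runs_Nil: "runs \<phi> [] 0 ts ts"
  by (simp add: runs_def reaches_0)

lemma runs_append:
  assumes "runs \<phi> cs n ts ts'" "runs \<phi> ds m ts' ts''"
  shows "runs \<phi> (cs @ ds) (n + m) ts ts''"
  unfolding runs_def
proof (intro allI)
  fix as bs
  have "reaches (compile (as @ cs @ ds @ bs)) \<phi> n (4 + length as, ts) (4 + length as + length cs, ts')"
    using assms(1) by (simp add: runs_def)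
  moreover have "reaches (compile ((as @ cs) @ ds @ bs)) \<phi> m
      (4 + length (as @ cs), ts') (4 + length (as @ cs) + length ds, ts'')"
    using assms(2) unfolding runs_def by blast
  ultimately show "reaches (compile (as @ (cs @ ds) @ bs)) \<phi> (n + m) (4 + length as, ts)
      (4 + length as + length (cs @ ds), ts'')"
    by (simp add: reaches_trans add.assoc)
qed

lemma runs_single:
  assumes "\<And>cs i. i < length cs \<Longrightarrow> cs ! i = c \<Longrightarrow> reaches (compile cs) \<phi> n (4 + i, ts) (5 + i, ts')"
  shows "runs \<phi> [c] n ts ts'"
  unfolding runs_def
proof (intro allI)
  fix as bs
  show "reaches (compile (as @ [c] @ bs)) \<phi> n (4 + length as, ts) (4 + length as + length [c], ts')"
    using assms[of "length as" "as @ [c] @ bs"] by simp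
qed

lemma runs_Scan_right:
  assumes "s \<noteq> t" "s < length ts" "t < length ts" "ts ! s = tape_on w 0" "ts ! t = tape_end v"
  shows "runs \<phi> [Scan Move_Right s t f] (length w + 1) ts
    (ts[s := tape_on w (int (length w) - 1), t := tape_end (v @ map f w)])"
  using reaches_Scan_right_from[of _ _ s t f ts w 0 v \<phi>] assms by (intro runs_single) simp

lemma runs_Scan_left:
  assumes "s \<noteq> t" "s < length ts" "t < length ts"
    and "ts ! s = tape_on w (int (length w) - 1)" "ts ! t = tape_end v"
  shows "runs \<phi> [Scan Move_Left s t f] (length w + 1) ts
    (ts[s := tape_on w 0, t := tape_end (v @ map f (rev w))])"
  using reaches_Scan_left_from[of _ _ s t f ts w "length w" v \<phi>] assms by (intro runs_single) simp

lemma runs_replicate_Put: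
  assumes "t < length ts" "ts ! t = tape_end w"
  shows "runs \<phi> (replicate k (Put t b)) k ts (ts[t := tape_end (w @ replicate k b)])"
  using assms
proof (induction k arbitrary: w ts)
  case 0
  then have "ts[t := tape_end w] = ts" by (metis list_update_id)
  then show ?case by (simp add: runs_Nil)
next
  case (Suc k)
  have "runs \<phi> [Put t b] 1 ts (ts[t := tape_end (w @ [b])])"
    using Suc.prems reaches_Put by (intro runs_single) blast
  from runs_append[OF this Suc.IH[of _ "w @ [b]"]] Suc.prems show ?case
    by simp
qed

text \<open>Going to and fro over tape \<open>s\<close> adds two zeros per letter and restores the
  head, so sweeps can be iterated. The output thus grows by a multiple of a length known only at run
  time.\<close>

definition sweeps :: "nat \<Rightarrow> nat \<Rightarrow> nat \<Rightarrow> instr list" where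
  "sweeps k s t = concat (replicate k
     [Scan Move_Right s t (\<lambda>_. False), Scan Move_Left s t (\<lambda>_. False)])"

lemma runs_sweeps:
  assumes "s \<noteq> t" "s < length ts" "t < length ts" "ts ! s = tape_on w 0" "ts ! t = tape_end v"
  shows "runs \<phi> (sweeps k s t) (k * (2 * (length w + 1))) ts
    (ts[t := tape_end (v @ replicate (2 * k * length w) False)])"
  using assms
proof (induction k arbitrary: v ts)
  case 0
  then have "ts[t := tape_end v] = ts" by (metis list_update_id)
  then show ?case by (simp add: runs_Nil sweeps_def)
next
  case (Suc k)
  let ?z = "replicate (length w) False"
  have z: "map (\<lambda>_. False) w = ?z" "map (\<lambda>_. False) (rev w) = ?z"
    by (simp_all add: map_replicate_const)
  have 1: "runs \<phi> [Scan Move_Right s t (\<lambda>_. False)] (length w + 1) ts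
      (ts[s := tape_on w (int (length w) - 1), t := tape_end (v @ ?z)])"
    using runs_Scan_right[OF Suc.prems, of \<phi> "\<lambda>_. False"] by (simp only: z)
  have 2: "runs \<phi> [Scan Move_Left s t (\<lambda>_. False)] (length w + 1)
      (ts[s := tape_on w (int (length w) - 1), t := tape_end (v @ ?z)])
      (ts[t := tape_end (v @ ?z @ ?z)])"
  proof -
    let ?ts = "ts[s := tape_on w (int (length w) - 1), t := tape_end (v @ ?z)]"
    have "runs \<phi> [Scan Move_Left s t (\<lambda>_. False)] (length w + 1) ?ts
        (?ts[s := tape_on w 0, t := tape_end ((v @ ?z) @ map (\<lambda>_. False) (rev w))])"
      using Suc.prems by (intro runs_Scan_left) simp_all
    moreover have "?ts[s := tape_on w 0, t := y] = ts[t := y]" for y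
      using Suc.prems by (intro nth_equalityI) (auto simp: nth_list_update)
    ultimately show ?thesis
      by (simp only: z append_assoc)
  qed
  have 3: "runs \<phi> (sweeps k s t) (k * (2 * (length w + 1))) (ts[t := tape_end (v @ ?z @ ?z)])
      (ts[t := tape_end ((v @ ?z @ ?z) @ replicate (2 * k * length w) False)])"
    using Suc.IH[of "ts[t := tape_end (v @ ?z @ ?z)]" "v @ ?z @ ?z"] Suc.prems by simp
  have "(v @ ?z @ ?z) @ replicate (2 * k * length w) False = v @ replicate (2 * Suc k * length w) False"
    by (simp add: replicate_add[symmetric] algebra_simps)
  with runs_append[OF runs_append[OF 1 2] 3] show ?case
    by (simp add: sweeps_def algebra_simps)
qed

text \<open>Three steps: store the return address, ask the oracle, jump back. Tape 4 is blank again
  afterwards, so further queries can follow.\<close>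

lemma runs_Query:
  "runs \<phi> [Query] 3 [a, b, tape_on w h, d, blank_tape] [a, b, blank_tape, string_tape (\<phi> w), blank_tape]"
proof (rule runs_single)
  fix cs and i :: nat
  assume i: "i < length cs" "cs ! i = Query"
  \<comment> \<open>The symbol is \<open>Suc i\<close> because state 3 then continues in state
    \<open>4 + Suc i\<close>, just after the query.\<close>
  let ?M = "compile cs" and ?pc = "(0, (\<lambda>_. 0)(0 := Suc i)) :: tape"
  have "step ?M \<phi> (4 + i, [a, b, tape_on w h, d, blank_tape]) = (2, [a, b, tape_on w h, d, ?pc])"
    unfolding step_instr[OF i(1)] i instr_trans_def
    by (simp add: map2_tape_act_update map2_tape_act_idle blank_tape_def del: step.simps list.map)
  moreover have "step ?M \<phi> (2, [a, b, tape_on w h, d, ?pc])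
      = (3, [a, b, blank_tape, string_tape (\<phi> w), ?pc])"
    by (simp add: eval_nat_numeral)
  moreover have "step ?M \<phi> (3, [a, b, blank_tape, string_tape (\<phi> w), ?pc])
      = (5 + i, [a, b, blank_tape, string_tape (\<phi> w), blank_tape])"
  proof -
    define ts where "ts = [a, b, blank_tape, string_tape (\<phi> w), ?pc]"
    have "length ts = 5"
      by (simp add: ts_def)
    then have "step ?M \<phi> (3, ts) = (4 + tape_read (ts ! 4), ts[4 := tape_act (0, Stay) (ts ! 4)])"
      by (simp add: compile_def map2_tape_act_update map2_tape_act_idle del: tape_act.simps)
    then show ?thesis
      by (simp add: ts_def tape_read_def blank_tape_def fun_upd_idem del: step.simps)
  qed
  ultimately show "reaches ?M \<phi> 3 (4 + i, [a, b, tape_on w h, d, blank_tape])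
      (5 + i, [a, b, blank_tape, string_tape (\<phi> w), blank_tape])"
    by (simp add: reaches_def numeral_3_eq_3 del: step.simps)
qed

text \<open>The two extra steps enter the program from the initial state and leave it for the
  halting state.\<close>

lemma computes_within_compile:
  assumes "runs \<phi> cs n [string_tape a, blank_tape, blank_tape, blank_tape, blank_tape] ts"
    and "ts ! 1 = tape_on b h"
  shows "computes_within (compile cs) \<phi> [a] b (n + 2)"
proof -
  let ?M = "compile cs"
  define ts0 where "ts0 = [string_tape a, blank_tape, blank_tape, blank_tape, blank_tape]"
  have init: "init_config ?M [a] = (0, ts0)"
    by (simp add: init_config_def compile_def string_tape_def ts0_def eval_nat_numeral)
  have "step ?M \<phi> (0, ts0) = (4, ts0)"
    by (simp add: compile_def map2_tape_act_idle)
  then have 1: "reaches ?M \<phi> 1 (0, ts0) (4, ts0)"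
    using reaches_step by metis
  have 2: "reaches ?M \<phi> n (4, ts0) (4 + length cs, ts)"
    using assms(1)[unfolded runs_def, rule_format, of "[]" "[]"] by (simp add: ts0_def)
  have "step ?M \<phi> (4 + length cs, ts) = (1, ts)"
    by (simp add: compile_def map2_tape_act_idle)
  then have 3: "reaches ?M \<phi> 1 (4 + length cs, ts) (1, ts)"
    using reaches_step by metis
  have "reaches ?M \<phi> (n + 2) (0, ts0) (1, ts)"
    using reaches_trans[OF reaches_trans[OF 1 2] 3] by simp
  then show ?thesis
    using assms(2) unfolding computes_within_def reaches_def init by (intro exI[of _ "n + 2"]) simp
qed

section \<open>The padding machine\<close>

lemma length_eq_fun_size:
  assumes "length_monotone \<phi>"
  shows "length (\<phi> w) = fun_size \<phi> (length w)"
  using assms unfolding length_monotone_def fun_size_def ones_def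
  by (metis dual_order.refl length_replicate order_antisym)

lemma fun_size_mono:
  assumes "length_monotone \<phi>" "m \<le> n"
  shows "fun_size \<phi> m \<le> fun_size \<phi> n"
  using assms by (simp add: length_monotone_def fun_size_def ones_def)

text \<open>The second query is a string of length \<open>length a + m\<close>; only the length of its answer matters.\<close>

definition pad_program :: "nat \<Rightarrow> nat \<Rightarrow> instr list" where
  "pad_program k m = [Scan Move_Right 0 2 (\<lambda>b. b)] @ [Query] @ [Scan Move_Right 3 1 (\<lambda>b. b)] @
     [Scan Move_Left 0 2 (\<lambda>b. b)] @ replicate m (Put 2 False) @ [Query] @
     replicate m (Put 1 False) @ sweeps k 0 1 @ sweeps k 3 1"

lemma pad_program_computes:
  assumes "length_monotone \<phi>"
  shows "computes_within (compile (pad_program k m)) \<phi> [a]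
    (\<phi> a @ replicate (m + 2 * k * length a + 2 * k * fun_size \<phi> (length a + m)) False)
    (4 * k + 2 * m + 11 + (2 * k + 2) * length a + fun_size \<phi> (length a)
       + 2 * k * fun_size \<phi> (length a + m))"
proof -
  let ?B = blank_tape
  note len = length_eq_fun_size[OF assms]
  \<comment> \<open>The second query contains the input reversed, because it is copied while
    scanning to the left.\<close>
  define w where "w = rev a @ replicate m False"
  have lw: "length (\<phi> w) = fun_size \<phi> (length a + m)"
    by (simp add: len w_def)
  define i where "i = int (length a) - 1"
  define j where "j = int (length (\<phi> a)) - 1"
  have 1: "runs \<phi> [Scan Move_Right 0 2 (\<lambda>b. b)] (length a + 1) [string_tape a, ?B, ?B, ?B, ?B]
     [tape_on a i, ?B, tape_end a, ?B, ?B]"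
    using runs_Scan_right[of 0 2 "[string_tape a, ?B, ?B, ?B, ?B]" a "[]" \<phi> "\<lambda>b. b"]
    by (simp add: string_tape_eq blank_tape_eq eval_nat_numeral i_def)
  have 2: "runs \<phi> [Query] 3 [tape_on a i, ?B, tape_end a, ?B, ?B]
     [tape_on a i, ?B, ?B, string_tape (\<phi> a), ?B]"
    by (rule runs_Query)
  \<comment> \<open>The first answer is copied to the output now, since the second query overwrites
    the answer tape.\<close>
  have 3: "runs \<phi> [Scan Move_Right 3 1 (\<lambda>b. b)] (length (\<phi> a) + 1)
     [tape_on a i, ?B, ?B, string_tape (\<phi> a), ?B]
     [tape_on a i, tape_end (\<phi> a), ?B, tape_on (\<phi> a) j, ?B]"
    using runs_Scan_right[of 3 1 "[tape_on a i, ?B, ?B, string_tape (\<phi> a), ?B]" "\<phi> a" "[]" \<phi> "\<lambda>b. b"]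
    by (simp add: string_tape_eq blank_tape_eq eval_nat_numeral j_def)
  \<comment> \<open>This scan prepares the second query and also returns the input head to cell 0,
    where the sweeps over the input start.\<close>
  have 4: "runs \<phi> [Scan Move_Left 0 2 (\<lambda>b. b)] (length a + 1)
     [tape_on a i, tape_end (\<phi> a), ?B, tape_on (\<phi> a) j, ?B]
     [tape_on a 0, tape_end (\<phi> a), tape_end (rev a), tape_on (\<phi> a) j, ?B]"
    using runs_Scan_left[of 0 2 "[tape_on a i, tape_end (\<phi> a), ?B, tape_on (\<phi> a) j, ?B]" a "[]" \<phi> "\<lambda>b. b"]
    by (simp add: i_def blank_tape_eq eval_nat_numeral)
  have 5: "runs \<phi> (replicate m (Put 2 False)) m
     [tape_on a 0, tape_end (\<phi> a), tape_end (rev a), tape_on (\<phi> a) j, ?B]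
     [tape_on a 0, tape_end (\<phi> a), tape_end w, tape_on (\<phi> a) j, ?B]"
    using runs_replicate_Put[of 2 "[tape_on a 0, tape_end (\<phi> a), tape_end (rev a), tape_on (\<phi> a) j, ?B]" "rev a" \<phi> m False]
    by (simp add: w_def eval_nat_numeral)
  have 6: "runs \<phi> [Query] 3 [tape_on a 0, tape_end (\<phi> a), tape_end w, tape_on (\<phi> a) j, ?B]
     [tape_on a 0, tape_end (\<phi> a), ?B, tape_on (\<phi> w) 0, ?B]"
    using runs_Query by (simp add: string_tape_eq)
  have 7: "runs \<phi> (replicate m (Put 1 False)) m
     [tape_on a 0, tape_end (\<phi> a), ?B, tape_on (\<phi> w) 0, ?B]
     [tape_on a 0, tape_end (\<phi> a @ replicate m False), ?B, tape_on (\<phi> w) 0, ?B]"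
    using runs_replicate_Put[of 1 "[tape_on a 0, tape_end (\<phi> a), ?B, tape_on (\<phi> w) 0, ?B]" "\<phi> a" \<phi> m False]
    by simp
  define v where "v = \<phi> a @ replicate m False @ replicate (2 * k * length a) False"
  have 8: "runs \<phi> (sweeps k 0 1) (k * (2 * (length a + 1)))
     [tape_on a 0, tape_end (\<phi> a @ replicate m False), ?B, tape_on (\<phi> w) 0, ?B]
     [tape_on a 0, tape_end v, ?B, tape_on (\<phi> w) 0, ?B]"
    using runs_sweeps[of 0 1 "[tape_on a 0, tape_end (\<phi> a @ replicate m False), ?B, tape_on (\<phi> w) 0, ?B]"
        a "\<phi> a @ replicate m False" \<phi> k]
    by (simp add: v_def)
  define u where "u = v @ replicate (2 * k * length (\<phi> w)) False"
  have 9: "runs \<phi> (sweeps k 3 1) (k * (2 * (length (\<phi> w) + 1)))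
     [tape_on a 0, tape_end v, ?B, tape_on (\<phi> w) 0, ?B]
     [tape_on a 0, tape_end u, ?B, tape_on (\<phi> w) 0, ?B]"
    using runs_sweeps[of 3 1 "[tape_on a 0, tape_end v, ?B, tape_on (\<phi> w) 0, ?B]" "\<phi> w" v \<phi> k]
    by (simp add: u_def eval_nat_numeral)
  have u: "u = \<phi> a @ replicate (m + 2 * k * length a + 2 * k * fun_size \<phi> (length a + m)) False"
    by (simp add: u_def v_def lw replicate_add)
  note runs = runs_append[OF 1 runs_append[OF 2 runs_append[OF 3 runs_append[OF 4 runs_append[OF 5
    runs_append[OF 6 runs_append[OF 7 runs_append[OF 8 9]]]]]]], folded pad_program_def]
  have "computes_within (compile (pad_program k m)) \<phi> [a] u
      (length a + 1 + (3 + (length (\<phi> a) + 1 + (length a + 1 + (m + (3 + (m +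
        (k * (2 * (length a + 1)) + k * (2 * (length (\<phi> w) + 1))))))))) + 2)"
    by (rule computes_within_compile[OF runs]) simp
  then show ?thesis
    unfolding u lw len[of a]
    by (rule back_subst[of "computes_within _ _ _ _"]) (simp add: algebra_simps)
qed

section \<open>The running time as a second-order polynomial\<close>

lemma second_order_poly_const: "second_order_poly (\<lambda>l n. c)"
  using second_order_poly.base[of "[:int c:]"] by simp

lemma second_order_poly_arg: "second_order_poly (\<lambda>l n. n)"
  using second_order_poly.base[of "[:0, 1:]"] by simp

lemma second_order_poly_pad_time:
  "second_order_poly (\<lambda>l n. 4 * k + 2 * m + 11 + (2 * k + 2) * n + l n + 2 * k * l (n + m))"
proof -
  note c = second_order_poly_const and a = second_order_poly_arg
  have "second_order_poly (\<lambda>l n. (4 * k + 2 * m + 11) + (2 * k + 2) * n)"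
    by (rule second_order_poly.add[OF c second_order_poly.mult[OF c a]])
  moreover have "second_order_poly (\<lambda>l n. l n)"
    by (rule second_order_poly.app[OF a])
  moreover have "second_order_poly (\<lambda>l n. (2 * k) * l (n + m))"
    by (rule second_order_poly.mult[OF c second_order_poly.app[OF second_order_poly.add[OF a c]]])
  ultimately show ?thesis
    by (rule second_order_poly.add[OF second_order_poly.add])
qed

section \<open>Dyadic codes\<close>

text \<open>Positive sign, block \<open>10\<close> for one digit before the binary point, digit 1:
  the value is \<open>2 * (1 / 2)\<close>.\<close>

lemma dyadic_one: "dyadic [False, True, False, True] = 1"
  by (simp add: Let_def)

text \<open>Behind a closed block the zeros are trailing digits. If the code stops within its block
  of ones, the first new zero closes the block with the same \<open>k\<close>; if the code is empty,
  the first zero becomes a positive sign. In both of these cases all digits are 0.\<close>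

lemma dyadic_append_zeros: "dyadic (w @ replicate k False) = dyadic w"
proof (cases w)
  case Nil
  then show ?thesis
    by (cases k) (auto simp: Let_def intro!: sum.neutral)
next
  case (Cons s v)
  define i where "i = length (takeWhile id v)"
  have le: "i \<le> length v"
    by (simp add: i_def length_takeWhile_le)
  have tw: "length (takeWhile id (v @ replicate k False)) = i"
  proof (cases "\<exists>x\<in>set v. \<not> id x")
    case True
    then show ?thesis by (auto simp: i_def takeWhile_append1)
  next
    case False
    then have "takeWhile id v = v" by (simp add: takeWhile_eq_all_conv)
    moreover have "takeWhile id (v @ replicate k False) = v @ takeWhile id (replicate k False)"
      using False by (intro takeWhile_append2) auto
    moreover have "takeWhile id (replicate k False) = []"
      by (cases k) simp_all
    ultimately show ?thesis by (metis append_Nil2 i_def)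
  qed
  let ?e = "drop (Suc i) (v @ replicate k False)"
  have "(\<Sum>j<length ?e. of_bool (?e ! j) / 2 ^ Suc j)
      = (\<Sum>j<length (drop (Suc i) v). of_bool (drop (Suc i) v ! j) / 2 ^ Suc j :: real)"
  proof (rule sum.mono_neutral_cong_right)
    show "\<forall>j\<in>{..<length ?e} - {..<length (drop (Suc i) v)}. of_bool (?e ! j) / 2 ^ Suc j = (0::real)"
      by (auto simp: nth_append)
  qed (auto simp: nth_append)
  then show ?thesis
    using tw by (simp add: Cons Let_def i_def del: drop_append)
qed

text \<open>The digits contribute at most 1, and the \<open>k\<close> in the factor
  \<open>2 ^ k\<close> is at most the length of the code. This turns the length of an oracle answer
  into a bound for an integral.\<close>

lemma abs_dyadic_le: "\<bar>dyadic w\<bar> \<le> 2 ^ length w"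
proof (cases w)
  case (Cons s v)
  define i where "i = length (takeWhile id v)"
  define d where "d = drop (Suc i) v"
  have i: "i \<le> length v"
    by (simp add: i_def length_takeWhile_le)
  have "(\<Sum>j<length d. of_bool (d ! j) / 2 ^ Suc j) \<le> (\<Sum>j<length d. (1 / 2) ^ Suc j :: real)"
    by (intro sum_mono) (auto simp: power_divide)
  also have "\<dots> = 1 - (1 / 2) ^ length d"
    using sum_gp_strict[of "1 / 2 :: real" "length d"]
    by (simp only: power_Suc sum_distrib_left[symmetric]) simp
  also have "\<dots> \<le> 1" by simp
  finally have s: "(\<Sum>j<length d. of_bool (d ! j) / 2 ^ Suc j) \<le> (1::real)" .
  have "\<bar>dyadic w\<bar> = 2 ^ i * (\<Sum>j<length d. of_bool (d ! j) / 2 ^ Suc j)"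
    by (simp add: Cons Let_def i_def d_def abs_mult sum_nonneg)
  also have "\<dots> \<le> 2 ^ i * 1"
    using s by (intro mult_left_mono) auto
  also have "\<dots> \<le> 2 ^ length w"
    using i power_increasing[of i "length w" "2::real"] by (simp add: Cons)
  finally show ?thesis .
qed simp

section \<open>Weak derivatives and primitives\<close>

lemma absolutely_integrable_mult_continuous:
  fixes v q :: "real \<Rightarrow> real"
  assumes "v absolutely_integrable_on {a..b}" "continuous_on {a..b} q"
  shows "(\<lambda>x. v x * q x) absolutely_integrable_on {a..b}"
proof -
  have "(\<lambda>x. q x * v x) absolutely_integrable_on {a..b}"
    using assms
    by (intro absolutely_integrable_bounded_measurable_product_real)
      (auto intro!: continuous_imp_measurable_on_sets_lebesgue compact_imp_bounded compact_continuous_image)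
  then show ?thesis by (simp add: mult.commute)
qed

text \<open>By Stone-Weierstrass, polynomials approximate the continuous factor uniformly, and an
  error \<open>e\<close> there changes the integral by at most \<open>e\<close> times the L1 norm of
  \<open>v\<close>.\<close>

lemma integral_mult_continuous_eq_0:
  fixes v \<phi> :: "real \<Rightarrow> real"
  assumes v: "v absolutely_integrable_on {a..b}" and \<phi>: "continuous_on {a..b} \<phi>"
    and orth: "\<And>q. real_polynomial_function q \<Longrightarrow> integral {a..b} (\<lambda>x. v x * q x) = 0"
  shows "integral {a..b} (\<lambda>x. v x * \<phi> x) = 0"
proof (rule ccontr)
  define A where "A = \<bar>integral {a..b} (\<lambda>x. v x * \<phi> x)\<bar>"
  define J where "J = integral {a..b} (\<lambda>x. \<bar>v x\<bar>)"
  assume "integral {a..b} (\<lambda>x. v x * \<phi> x) \<noteq> 0"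
  then have A: "A > 0" by (simp add: A_def)
  have J: "J \<ge> 0" unfolding J_def by (rule integral_nonneg) (use v in \<open>auto simp: absolutely_integrable_on_def\<close>)
  \<comment> \<open>Chosen so that \<open>e * J < A\<close>; the summand 1 covers
    \<open>J = 0\<close>.\<close>
  define e where "e = A / (J + 1)"
  have e: "e > 0" using A J by (simp add: e_def)
  obtain q where q: "real_polynomial_function q" "\<And>x. x \<in> {a..b} \<Longrightarrow> \<bar>\<phi> x - q x\<bar> < e"
    using Stone_Weierstrass_real_polynomial_function[OF compact_Icc \<phi> e] by blast
  have cq: "continuous_on {a..b} q"
    using q(1) by (simp add: continuous_on_polymonial_function real_polynomial_function_eq)
  note i1 = absolutely_integrable_mult_continuous[OF v \<phi>, THEN set_lebesgue_integral_eq_integral(1)]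
  note i2 = absolutely_integrable_mult_continuous[OF v cq, THEN set_lebesgue_integral_eq_integral(1)]
  have "integral {a..b} (\<lambda>x. v x * \<phi> x) = integral {a..b} (\<lambda>x. v x * \<phi> x - v x * q x)"
    using orth[OF q(1)] by (simp add: Henstock_Kurzweil_Integration.integral_diff[OF i1 i2])
  also have "norm \<dots> \<le> integral {a..b} (\<lambda>x. e * \<bar>v x\<bar>)"
  proof (rule integral_norm_bound_integral)
    show "(\<lambda>x. e * \<bar>v x\<bar>) integrable_on {a..b}"
      using v by (intro integrable_on_mult_right) (auto simp: absolutely_integrable_on_def)
    fix x assume "x \<in> {a..b}"
    then have "\<bar>v x\<bar> * \<bar>\<phi> x - q x\<bar> \<le> \<bar>v x\<bar> * e"
      using q(2) by (intro mult_left_mono) (auto intro: less_imp_le)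
    then show "norm (v x * \<phi> x - v x * q x) \<le> e * \<bar>v x\<bar>"
      by (simp add: abs_mult[symmetric] algebra_simps)
  qed (intro integrable_diff i1 i2)
  finally have "A \<le> e * J"
    by (simp add: A_def J_def)
  moreover have "e * J < A"
    using A J by (simp add: e_def field_simps)
  ultimately show False by simp
qed

lemma AE_lebesgue_on_iff_negligible:
  fixes P :: "real \<Rightarrow> bool"
  assumes "S \<in> sets lebesgue"
  shows "(AE x in lebesgue_on S. P x) \<longleftrightarrow> negligible {x \<in> S. \<not> P x}"
proof -
  have "(AE x in lebesgue_on S. P x) \<longleftrightarrow> (AE x in lebesgue. x \<in> S \<longrightarrow> P x)"
    using assms by (simp add: AE_restrict_space_iff)
  also have "\<dots> \<longleftrightarrow> (\<exists>N\<in>null_sets lebesgue. {x \<in> S. \<not> P x} \<subseteq> N)"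
    unfolding eventually_ae_filter by simp
  also have "\<dots> \<longleftrightarrow> negligible {x \<in> S. \<not> P x}"
    unfolding negligible_iff_null_sets[symmetric] Bex_def mem_Collect_eq
    by (metis negligible_iff_null_sets negligible_subset order_refl)
  finally show ?thesis .
qed

text \<open>The sign of \<open>v\<close> is an almost everywhere limit of continuous functions, to
  which \<open>v\<close> is orthogonal by the previous approximation. Dominated convergence then
  shows that the integral of \<open>\<bar>v\<bar>\<close> is 0.\<close>

lemma negligible_if_orthogonal_to_polynomials:
  fixes v :: "real \<Rightarrow> real"
  assumes v: "v absolutely_integrable_on {a..b}"
    and orth: "\<And>q. real_polynomial_function q \<Longrightarrow> integral {a..b} (\<lambda>x. v x * q x) = 0"
  shows "negligible {x \<in> {a..b}. v x \<noteq> 0}"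
proof -
  let ?S = "{a..b}"
  have "v \<in> borel_measurable (lebesgue_on ?S)"
    using v by (simp add: absolutely_integrable_imp_borel_measurable)
  then have "(\<lambda>x. if x \<in> ?S then v x else 0) \<in> borel_measurable lebesgue"
    by (rule borel_measurable_if_I) simp
  then have "(\<lambda>x. sgn (if x \<in> ?S then v x else 0)) \<in> borel_measurable lebesgue"
    by measurable
  then have "(\<lambda>x. sgn (if x \<in> ?S then v x else 0)) measurable_on UNIV"
    by (intro lebesgue_measurable_imp_measurable_on) auto
  then obtain N g where N: "negligible N" and g: "\<And>n. continuous_on UNIV (g n :: real \<Rightarrow> real)"
    and lim: "\<And>x. x \<notin> N \<Longrightarrow> (\<lambda>n. g n x) \<longlonglongrightarrow> sgn (if x \<in> ?S then v x else 0)"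
    unfolding measurable_on_def by auto
  \<comment> \<open>Clipping keeps the limit, as signs lie in \<open>{-1..1}\<close>, and provides
    the majorant \<open>\<bar>v x\<bar>\<close>.\<close>
  define c where "c n x = max (-1) (min 1 (g n x))" for n x
  have c: "continuous_on ?S (c n)" for n
    unfolding c_def by (intro continuous_intros continuous_on_subset[OF g]) auto
  \<comment> \<open>Setting the integrands to 0 on the null set \<open>N\<close> makes them converge
    at every point of the interval, the form in which dominated convergence is applied.\<close>
  define w where "w n x = (if x \<in> N then 0 else v x * c n x)" for n x
  have iw: "integral ?S (w n) = 0" for n
  proof -
    have "integral ?S (w n) = integral ?S (\<lambda>x. v x * c n x)"
      by (rule integral_spike[OF N]) (simp add: w_def)
    then show ?thesis
      using integral_mult_continuous_eq_0[OF v c orth] by simp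
  qed
  have "(\<lambda>n. integral ?S (w n)) \<longlonglongrightarrow> integral ?S (\<lambda>x. if x \<in> N then 0 else \<bar>v x\<bar>)"
  proof (rule dominated_convergence(2)[where h = "\<lambda>x. \<bar>v x\<bar>"])
    show "w n integrable_on ?S" for n
      by (rule integrable_spike[OF _ N, of "\<lambda>x. v x * c n x"])
        (use absolutely_integrable_mult_continuous[OF v c] in
          \<open>auto simp: w_def dest: set_lebesgue_integral_eq_integral(1)\<close>)
    show "(\<lambda>x. \<bar>v x\<bar>) integrable_on ?S"
      using v by (auto simp: absolutely_integrable_on_def)
    show "norm (w n x) \<le> \<bar>v x\<bar>" for n x
    proof -
      have "\<bar>v x\<bar> * \<bar>c n x\<bar> \<le> \<bar>v x\<bar> * 1"
        by (intro mult_left_mono) (auto simp: c_def)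
      then show ?thesis by (auto simp: w_def abs_mult)
    qed
    show "(\<lambda>n. w n x) \<longlonglongrightarrow> (if x \<in> N then 0 else \<bar>v x\<bar>)" if "x \<in> ?S" for x
    proof (cases "x \<in> N")
      case False
      have "(\<lambda>n. c n x) \<longlonglongrightarrow> max (-1) (min 1 (sgn (v x)))"
        unfolding c_def using lim[OF False] that by (intro tendsto_intros) auto
      moreover have "max (-1) (min 1 (sgn (v x))) = sgn (v x)"
        by (simp add: sgn_if)
      ultimately have "(\<lambda>n. v x * c n x) \<longlonglongrightarrow> v x * sgn (v x)"
        by (intro tendsto_intros) simp
      then show ?thesis
        using False by (simp add: w_def mult_sgn_abs abs_sgn[symmetric])
    qed (simp add: w_def)
  qed
  then have "integral ?S (\<lambda>x. if x \<in> N then 0 else \<bar>v x\<bar>) = 0"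
    unfolding iw by (simp add: LIMSEQ_const_iff)
  then have "integral ?S (\<lambda>x. \<bar>v x\<bar>) = 0"
    using integral_spike[OF N, of ?S "\<lambda>x. \<bar>v x\<bar>" "\<lambda>x. if x \<in> N then 0 else \<bar>v x\<bar>"] by simp
  moreover have int: "integrable (lebesgue_on ?S) (\<lambda>x. \<bar>v x\<bar>)"
    using v by (simp add: absolutely_integrable_measurable_real)
  ultimately have "integral\<^sup>L (lebesgue_on ?S) (\<lambda>x. \<bar>v x\<bar>) = 0"
    by (simp add: lebesgue_integral_eq_integral)
  then have "AE x in lebesgue_on ?S. v x = 0"
    using integral_nonneg_eq_0_iff_AE[OF int] by simp
  then show ?thesis
    by (simp add: AE_lebesgue_on_iff_negligible)
qed

text \<open>Cutting the interval into \<open>n\<close> equal pieces bounds the total increment by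
  \<open>(W 1 - W 0) / n\<close>, for every positive \<open>n\<close>. This replaces the argument
  that a function with derivative 0 is constant.\<close>

lemma eq_ends_if_increments_small:
  fixes H W :: "real \<Rightarrow> real"
  assumes "\<And>x y. 0 \<le> x \<Longrightarrow> x \<le> y \<Longrightarrow> y \<le> 1 \<Longrightarrow> \<bar>H y - H x\<bar> \<le> (y - x) * (W y - W x)"
  shows "H 1 = H 0"
proof (rule ccontr)
  assume "H 1 \<noteq> H 0"
  then have pos: "\<bar>H 1 - H 0\<bar> > 0" by simp
  obtain n :: nat where n: "W 1 - W 0 < real n * \<bar>H 1 - H 0\<bar>" "n > 0"
  proof -
    obtain n :: nat where "W 1 - W 0 < real n * \<bar>H 1 - H 0\<bar>"
      using reals_Archimedean3[OF pos] by blast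
    then have "W 1 - W 0 < real (Suc n) * \<bar>H 1 - H 0\<bar>"
      using pos by (simp add: algebra_simps)
    then show ?thesis using that by blast
  qed
  define x where "x i = real i / real n" for i
  have step: "\<bar>H (x (Suc i)) - H (x i)\<bar> \<le> (W (x (Suc i)) - W (x i)) / real n" if "i < n" for i
  proof -
    have "x (Suc i) - x i = 1 / real n"
      by (simp add: x_def add_divide_distrib)
    moreover have "0 \<le> x i" "x i \<le> x (Suc i)" "x (Suc i) \<le> 1"
      using that by (auto simp: x_def field_simps)
    ultimately show ?thesis
      using assms[of "x i" "x (Suc i)"] by (simp add: field_simps)
  qed
  have x: "x 0 = 0" "x n = 1"
    using n by (simp_all add: x_def)
  have "\<bar>H 1 - H 0\<bar> = \<bar>\<Sum>i<n. H (x (Suc i)) - H (x i)\<bar>"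
    using sum_lessThan_telescope[of "\<lambda>i. H (x i)" n] by (simp add: x)
  also have "\<dots> \<le> (\<Sum>i<n. (W (x (Suc i)) - W (x i)) / real n)"
    using step by (intro order_trans[OF sum_abs] sum_mono) auto
  also have "\<dots> = (W 1 - W 0) / real n"
    using sum_lessThan_telescope[of "\<lambda>i. W (x i)" n]
    by (simp add: x sum_divide_distrib[symmetric])
  finally show False
    using n by (simp add: field_simps)
qed

section \<open>Primitives of integrable functions and integration by parts\<close>

context
  fixes g :: "real \<Rightarrow> real"
  assumes g: "g absolutely_integrable_on {0..1}"
begin

lemma indefinite_integral_diff:
  assumes "0 \<le> x" "x \<le> y" "y \<le> 1"
  shows "integral {0..y} g - integral {0..x} g = integral {x..y} g"
    and "integral {0..y} (\<lambda>t. \<bar>g t\<bar>) - integral {0..x} (\<lambda>t. \<bar>g t\<bar>) = integral {x..y} (\<lambda>t. \<bar>g t\<bar>)"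
    and "\<bar>integral {x..y} g\<bar> \<le> integral {x..y} (\<lambda>t. \<bar>g t\<bar>)"
    and "g integrable_on {x..y}" "(\<lambda>t. \<bar>g t\<bar>) integrable_on {x..y}"
proof -
  have 1: "g integrable_on {0..1}" "(\<lambda>t. \<bar>g t\<bar>) integrable_on {0..1}"
    using g by (auto simp: absolutely_integrable_on_def)
  have 2: "g integrable_on {u..v}" "(\<lambda>t. \<bar>g t\<bar>) integrable_on {u..v}" if "0 \<le> u" "v \<le> 1" for u v
    using 1 that by (auto intro: integrable_subinterval_real)
  show "integral {0..y} g - integral {0..x} g = integral {x..y} g"
    "integral {0..y} (\<lambda>t. \<bar>g t\<bar>) - integral {0..x} (\<lambda>t. \<bar>g t\<bar>) = integral {x..y} (\<lambda>t. \<bar>g t\<bar>)"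
    using assms Henstock_Kurzweil_Integration.integral_combine[of 0 x y g] Henstock_Kurzweil_Integration.integral_combine[of 0 x y "\<lambda>t. \<bar>g t\<bar>"] 2[of 0 y] by auto
  show "g integrable_on {x..y}" "(\<lambda>t. \<bar>g t\<bar>) integrable_on {x..y}"
    using assms 2 by auto
  then show "\<bar>integral {x..y} g\<bar> \<le> integral {x..y} (\<lambda>t. \<bar>g t\<bar>)"
    using integral_norm_bound_integral[of g "{x..y}" "\<lambda>t. \<bar>g t\<bar>"] by simp
qed

lemma indefinite_integral_abs_diff_le:
  assumes "0 \<le> x" "x \<le> y" "y \<le> 1"
  shows "\<bar>integral {0..y} g - integral {0..x} g\<bar>
    \<le> integral {0..y} (\<lambda>t. \<bar>g t\<bar>) - integral {0..x} (\<lambda>t. \<bar>g t\<bar>)"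
  using indefinite_integral_diff[OF assms] by simp

text \<open>The primitive of \<open>g\<close> need not be differentiable everywhere; the increments of the defect
  of the product rule are of second order, so the defect vanishes.\<close>

lemma integral_by_parts_indefinite:
  fixes D D' :: "real \<Rightarrow> real"
  assumes D: "\<And>x. x \<in> {0..1} \<Longrightarrow> (D has_real_derivative D' x) (at x within {0..1})"
    and D': "continuous_on {0..1} D'"
  shows "integral {0..1} (\<lambda>x. integral {0..x} g * D' x) + integral {0..1} (\<lambda>x. g x * D x)
    = integral {0..1} g * D 1"
proof -
  define G where "G x = integral {0..x} g" for x
  define V where "V x = integral {0..x} (\<lambda>t. \<bar>g t\<bar>)" for x
  have contG: "continuous_on {0..1} G"
    unfolding G_def using g by (intro indefinite_integral_continuous_1) (auto simp: absolutely_integrable_on_def)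
  have contD: "continuous_on {0..1} D"
    unfolding continuous_on_eq_continuous_within using D DERIV_continuous by blast
  have i1: "(\<lambda>x. G x * D' x) integrable_on {0..1}"
    by (intro integrable_continuous_real continuous_intros contG D')
  have i2: "(\<lambda>x. g x * D x) integrable_on {0..1}"
    using absolutely_integrable_mult_continuous[OF g contD] by (rule set_lebesgue_integral_eq_integral(1))
  define k where "k x = G x * D' x + g x * D x" for x
  have ik: "k integrable_on {0..1}"
    unfolding k_def by (intro integrable_add i1 i2)
  have iks: "k integrable_on {x..y}" if "0 \<le> x" "y \<le> 1" for x y
    using ik that by (auto intro: integrable_subinterval_real)
  obtain C where C: "\<And>x. x \<in> {0..1} \<Longrightarrow> \<bar>D' x\<bar> \<le> C"
    using compact_imp_bounded[OF compact_continuous_image[OF D' compact_Icc]]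
    unfolding bounded_iff by (metis imageI real_norm_def)
  have C0: "C \<ge> 0" using C[of 0] by auto
  have intD': "(D' has_integral (D y - D x)) {x..y}" if "0 \<le> x" "x \<le> y" "y \<le> 1" for x y
  proof (rule fundamental_theorem_of_calculus[OF that(2)])
    fix t assume "t \<in> {x..y}"
    then have "(D has_real_derivative D' t) (at t within {x..y})"
      using that by (intro DERIV_subset[OF D]) auto
    then show "(D has_vector_derivative D' t) (at t within {x..y})"
      by (simp add: has_real_derivative_iff_has_vector_derivative)
  qed
  have lipD: "\<bar>D y - D x\<bar> \<le> C * (y - x)" if "0 \<le> x" "x \<le> y" "y \<le> 1" for x y
    using has_integral_bound_real[OF C0 finite.emptyI intD'[OF that]] C that by simp
  \<comment> \<open>The defect of the product rule. As \<open>G 0 = 0\<close>, also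
    \<open>H 0 = 0\<close>, and \<open>H 1 = H 0\<close> is the claim.\<close>
  define H where "H x = integral {0..x} k - G x * D x" for x
  have "H 1 = H 0"
  proof (rule eq_ends_if_increments_small)
    fix x y :: real assume xy: "0 \<le> x" "x \<le> y" "y \<le> 1"
    have Gi: "(g has_integral (G y - G x)) {x..y}"
      using indefinite_integral_diff[OF xy] by (simp add: G_def has_integral_integrable_integral)
    have Vi: "((\<lambda>t. \<bar>g t\<bar>) has_integral (V y - V x)) {x..y}"
      using indefinite_integral_diff[OF xy] by (simp add: V_def has_integral_integrable_integral)
    have "integral {0..y} k - integral {0..x} k = integral {x..y} k"
      using Henstock_Kurzweil_Integration.integral_combine[of 0 x y k] xy iks[of 0 y] by simp
    then have "(k has_integral (integral {0..y} k - integral {0..x} k)) {x..y}"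
      using iks[of x y] xy by (simp add: has_integral_integrable_integral)
    \<comment> \<open>The increment of \<open>G * D\<close> is split as
      \<open>(G y - G x) * D y + G x * (D y - D x)\<close>, both summands being integrals with one
      factor frozen at an end point. Each term of the remaining integrand contains an increment of
      \<open>G\<close> or \<open>D\<close>, which yields the second order.\<close>
    from has_integral_diff[OF this has_integral_add[OF has_integral_mult_left[OF Gi, of "D y"]
          has_integral_mult_right[OF intD'[OF xy], of "G x"]]]
    have "((\<lambda>t. k t - (g t * D y + G x * D' t)) has_integral
        (integral {0..y} k - integral {0..x} k - ((G y - G x) * D y + G x * (D y - D x)))) {x..y}" .
    moreover have "(\<lambda>t. k t - (g t * D y + G x * D' t)) = (\<lambda>t. (G t - G x) * D' t + g t * (D t - D y))"
      by (simp add: k_def fun_eq_iff algebra_simps)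
    moreover have "integral {0..y} k - integral {0..x} k - ((G y - G x) * D y + G x * (D y - D x)) = H y - H x"
      by (simp add: H_def algebra_simps)
    ultimately have diff: "((\<lambda>t. (G t - G x) * D' t + g t * (D t - D y)) has_integral (H y - H x)) {x..y}"
      by simp
    have "((\<lambda>t. (V y - V x) * C) has_integral ((y - x) * ((V y - V x) * C))) {x..y}"
      using has_integral_const_real[of "(V y - V x) * C" x y] xy by simp
    from has_integral_add[OF this has_integral_mult_left[OF Vi, of "C * (y - x)"]]
    have bd: "((\<lambda>t. (V y - V x) * C + \<bar>g t\<bar> * (C * (y - x))) has_integral
        ((y - x) * ((V y - V x) * C) + (V y - V x) * (C * (y - x)))) {x..y}" .
    have "norm (integral {x..y} (\<lambda>t. (G t - G x) * D' t + g t * (D t - D y)))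
        \<le> integral {x..y} (\<lambda>t. (V y - V x) * C + \<bar>g t\<bar> * (C * (y - x)))"
    proof (rule integral_norm_bound_integral)
      fix t assume "t \<in> {x..y}"
      then have t: "x \<le> t" "t \<le> y" by auto
      have "\<bar>G t - G x\<bar> \<le> V t - V x" "V t \<le> V y"
        using indefinite_integral_abs_diff_le[of x t] indefinite_integral_abs_diff_le[of t y] t xy
        by (auto simp: G_def V_def)
      then have "\<bar>G t - G x\<bar> * \<bar>D' t\<bar> \<le> (V y - V x) * C"
        using C[of t] t xy by (intro mult_mono) auto
      moreover have "\<bar>g t\<bar> * \<bar>D t - D y\<bar> \<le> \<bar>g t\<bar> * (C * (y - x))"
      proof -
        have "\<bar>D t - D y\<bar> \<le> C * (y - t)"
          using lipD[of t y] t xy by (simp add: abs_minus_commute)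
        also have "\<dots> \<le> C * (y - x)"
          using t C0 by (intro mult_left_mono) auto
        finally show ?thesis by (intro mult_left_mono) auto
      qed
      ultimately show "norm ((G t - G x) * D' t + g t * (D t - D y)) \<le> (V y - V x) * C + \<bar>g t\<bar> * (C * (y - x))"
        unfolding abs_mult[symmetric] real_norm_def by linarith
    qed (rule has_integral_integrable[OF diff] has_integral_integrable[OF bd])+
    then have "\<bar>H y - H x\<bar> \<le> (y - x) * ((V y - V x) * C) + (V y - V x) * (C * (y - x))"
      unfolding integral_unique[OF diff] integral_unique[OF bd] real_norm_def .
    then show "\<bar>H y - H x\<bar> \<le> (y - x) * (2 * C * V y - 2 * C * V x)"
      by (simp add: algebra_simps)
  qed
  then have "integral {0..1} k = G 1 * D 1"
    by (simp add: H_def G_def)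
  then show ?thesis
    using Henstock_Kurzweil_Integration.integral_add[OF i1 i2] by (simp add: k_def[abs_def] G_def)
qed

end

section \<open>Functions with a weak derivative as primitives\<close>

lemma ex_pderiv_eq: "\<exists>Q. pderiv Q = (P :: real poly)"
proof
  show "pderiv (\<Sum>i\<le>degree P. monom (coeff P i / real (Suc i)) (Suc i)) = P"
    by (rule poly_eqI)
      (auto simp: coeff_pderiv coeff_sum coeff_eq_0 simp del: of_nat_Suc)
qed

lemma real_polynomial_function_ex_poly:
  assumes "real_polynomial_function (q :: real \<Rightarrow> real)"
  obtains P where "q = poly P"
proof -
  obtain a n where "q = (\<lambda>x. \<Sum>i\<le>n. a i * x ^ i)"
    using assms unfolding real_polynomial_function_iff_sum by auto
  then have "q = poly (\<Sum>i\<le>n. monom (a i) i)"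
    by (simp add: fun_eq_iff poly_sum poly_monom)
  then show ?thesis by (rule that)
qed

lemma has_integral_poly_pderiv:
  fixes Q :: "real poly"
  assumes "a \<le> b"
  shows "(poly (pderiv Q) has_integral (poly Q b - poly Q a)) {a..b}"
  using assms
  by (intro fundamental_theorem_of_calculus)
    (auto simp: has_real_derivative_iff_has_vector_derivative[symmetric]
      intro: DERIV_subset[OF poly_DERIV subset_UNIV])

lemma absolutely_integrable_on_if_Lp_funs_1:
  assumes "f \<in> Lp_funs 1"
  shows "f absolutely_integrable_on {0..1}"
  using assms by (auto simp: Lp_funs_def absolutely_integrable_measurable_real)

text \<open>The argument of du Bois-Reymond: \<open>u = f - G\<close> is orthogonal to the
  derivatives of test functions, and polynomials of mean 0 are such derivatives. Hence
  \<open>u\<close> minus its mean \<open>c\<close> is orthogonal to all polynomials and vanishes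
  almost everywhere.\<close>

lemma weak_derivative_primitive:
  assumes "weak_derivative f g"
  obtains c where "negligible {x \<in> {0..1}. f x \<noteq> c + integral {0..x} g}"
proof -
  have f: "f absolutely_integrable_on {0..1}" and g: "g absolutely_integrable_on {0..1}"
    using assms by (auto simp: weak_derivative_def absolutely_integrable_on_if_Lp_funs_1)
  define G where "G x = integral {0..x} g" for x
  have contG: "continuous_on {0..1} G"
    unfolding G_def using g
    by (intro indefinite_integral_continuous_1) (auto simp: absolutely_integrable_on_def)
  have G: "G absolutely_integrable_on {0..1}"
    by (rule absolutely_integrable_continuous_real[OF contG])
  define u where "u x = f x - G x" for x
  have u: "u absolutely_integrable_on {0..1}"
    unfolding u_def by (rule set_integral_diff(1)[OF f G])
  define c where "c = integral {0..1} u"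
  define v where "v x = u x - c" for x
  have v: "v absolutely_integrable_on {0..1}"
    unfolding v_def
    by (rule set_integral_diff(1)[OF u absolutely_integrable_continuous_real]) auto
  have "integral {0..1} (\<lambda>x. v x * q x) = 0" if poly: "real_polynomial_function q" for q
  proof -
    obtain P where q: "q = poly P"
      using real_polynomial_function_ex_poly[OF poly] .
    have contq: "continuous_on {0..1} q"
      unfolding q by (intro continuous_intros)
    \<comment> \<open>Subtracting the mean of \<open>q\<close> makes the antiderivative
      \<open>Q\<close> vanish at both end points, so that its iterated derivatives form a test
      function.\<close>
    define m where "m = integral {0..1} q"
    obtain Q0 where Q0: "pderiv Q0 = P - [:m:]"
      using ex_pderiv_eq by blast
    define Q where "Q = Q0 - [:poly Q0 0:]"
    define D where "D k = poly ((pderiv ^^ k) Q)" for k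
    have D0: "D 0 0 = 0"
      by (simp add: D_def Q_def)
    have pQ: "poly (pderiv Q) = (\<lambda>x. q x - m)"
      by (simp add: Q_def pderiv_diff Q0 fun_eq_iff q)
    have D1: "D 1 = (\<lambda>x. q x - m)"
      by (simp add: D_def pQ)
    have "integral {0..1} (\<lambda>x. q x - m) = 0"
      using Henstock_Kurzweil_Integration.integral_diff[OF integrable_continuous_real[OF contq]
          integrable_const_ivl, of m]
      by (simp add: m_def)
    moreover have "integral {0..1} (\<lambda>x. q x - m) = D 0 1 - D 0 0"
      using integral_unique[OF has_integral_poly_pderiv[of 0 1 Q]] by (simp add: pQ D_def)
    ultimately have D01: "D 0 1 = 0"
      using D0 by simp
    have der: "(D k has_real_derivative D (Suc k) x) (at x within {0..1})" for k x
      unfolding D_def by (auto intro: DERIV_subset[OF poly_DERIV subset_UNIV])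
    have cD: "continuous_on {0..1} (D k)" for k
      unfolding D_def by (intro continuous_intros)
    have "test_function D"
      unfolding test_function_def using der D0 D01 by blast
    then have weak: "(LINT x|lebesgue_on {0..1}. f x * D 1 x) = - (LINT x|lebesgue_on {0..1}. g x * D 0 x)"
      using assms by (simp add: weak_derivative_def)
    have conv: "(LINT x|lebesgue_on {0..1}. w x * D k x) = integral {0..1} (\<lambda>x. w x * D k x)"
      if "w absolutely_integrable_on {0..1}" for w k
      using absolutely_integrable_mult_continuous[OF that cD]
      by (intro lebesgue_integral_eq_integral absolutely_integrable_imp_integrable) auto
    have parts: "integral {0..1} (\<lambda>x. G x * D 1 x) + integral {0..1} (\<lambda>x. g x * D 0 x) = 0"
      using integral_by_parts_indefinite[OF g, of "D 0" "D 1"] der[of 0] cD[of 1] D01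
      by (simp add: G_def)
    have iD: "(\<lambda>x. w x * D 1 x) integrable_on {0..1}" if "w absolutely_integrable_on {0..1}" for w
      using absolutely_integrable_mult_continuous[OF that cD] by (rule set_lebesgue_integral_eq_integral(1))
    have "integral {0..1} (\<lambda>x. u x * D 1 x)
        = integral {0..1} (\<lambda>x. f x * D 1 x) - integral {0..1} (\<lambda>x. G x * D 1 x)"
      using Henstock_Kurzweil_Integration.integral_diff[OF iD[OF f] iD[OF G]]
      by (simp add: u_def left_diff_distrib)
    also have "\<dots> = 0"
      using weak parts by (simp add: conv f g)
    finally have orth: "integral {0..1} (\<lambda>x. u x * D 1 x) = 0" .
    have iu: "u integrable_on {0..1}"
      using u by (rule set_lebesgue_integral_eq_integral(1))
    \<comment> \<open>Here \<open>(u - c) * q = u * (q - m) + (m * u - c * q)\<close>. The first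
      summand is handled by \<open>orth\<close>, and the second integrates to
      \<open>m * c - c * m\<close>.\<close>
    have "integral {0..1} (\<lambda>x. v x * q x)
        = integral {0..1} (\<lambda>x. u x * D 1 x + (m * u x - c * q x))"
      unfolding v_def D1 by (rule Henstock_Kurzweil_Integration.integral_cong) (simp add: algebra_simps)
    also have "\<dots> = integral {0..1} (\<lambda>x. u x * D 1 x) + integral {0..1} (\<lambda>x. m * u x - c * q x)"
      by (intro Henstock_Kurzweil_Integration.integral_add integrable_diff iD u integrable_on_mult_right iu integrable_continuous_real contq)
    also have "integral {0..1} (\<lambda>x. m * u x - c * q x) = m * c - c * m"
      using Henstock_Kurzweil_Integration.integral_diff[OF integrable_on_mult_right[OF iu, of m]
          integrable_on_mult_right[OF integrable_continuous_real[OF contq], of c]]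
      by (simp add: c_def m_def)
    finally show ?thesis
      using orth by simp
  qed
  from negligible_if_orthogonal_to_polynomials[OF v this]
  have "negligible {x \<in> {0..1}. v x \<noteq> 0}" .
  also have "{x \<in> {0..1}. v x \<noteq> 0} = {x \<in> {0..1}. f x \<noteq> c + integral {0..x} g}"
    by (auto simp: v_def u_def G_def)
  finally show ?thesis by (rule that)
qed

section \<open>Moduli of zero extensions\<close>

text \<open>For bounded functions this reduces an Lp estimate to an L1 estimate.\<close>

lemma powr_le_mult_powr:
  fixes t b p :: real
  assumes "0 \<le> t" "t \<le> b" "1 \<le> p"
  shows "t powr p \<le> b powr (p - 1) * t"
proof (cases "t = 0")
  case False
  then have "t powr p = t powr (p - 1) * t"
    using assms powr_add[of t "p - 1" 1] by simp
  also have "\<dots> \<le> b powr (p - 1) * t"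
    using assms by (intro mult_right_mono powr_mono2) auto
  finally show ?thesis .
qed simp

text \<open>\<open>W\<close> is in general not integrable over the line, so the difference is
  computed on \<open>{-3..3}\<close>, outside of which it vanishes. There a shift by
  \<open>t\<close> enters the integral of \<open>W\<close> only through the length
  \<open>1 + t\<close> of \<open>{2..3 + t}\<close>, where \<open>W\<close> equals
  \<open>C\<close>.\<close>

lemma has_integral_shift_diff:
  fixes W :: "real \<Rightarrow> real"
  assumes mono: "\<And>x y. x \<le> y \<Longrightarrow> W x \<le> W y"
    and left: "\<And>x. x < 0 \<Longrightarrow> W x = 0" and right: "\<And>x. x > 1 \<Longrightarrow> W x = C" and h: "\<bar>h\<bar> \<le> 1"
  shows "((\<lambda>x. W (x + h) - W x) has_integral h * C) UNIV"
proof -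
  have iW: "W integrable_on {a..b}" for a b
    by (rule integrable_on_mono_on) (auto simp: mono_on_def mono)
  define J where "J = integral {-1..2} W"
  have shift: "((\<lambda>x. W (x + t)) has_integral (J + (1 + t) * C)) {-3..3}" if "\<bar>t\<bar> \<le> 1" for t
  proof -
    have "(W has_integral 0) {-3 + t..-1}"
      by (rule has_integral_is_0) (auto simp: left)
    moreover have "(W has_integral J) {-1..2}"
      unfolding J_def by (rule integrable_integral[OF iW])
    ultimately have "(W has_integral (0 + J)) {-3 + t..2}"
      by (rule has_integral_combine[rotated 2]) (use that in auto)
    moreover have "(W has_integral ((1 + t) * C)) {2..3 + t}"
    proof (rule has_integral_eq)
      show "((\<lambda>_. C) has_integral ((1 + t) * C)) {2..3 + t}"
        using has_integral_const_real[of C 2 "3 + t"] that by (simp add: abs_le_iff)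
    qed (auto simp: right)
    ultimately have "(W has_integral (0 + J + (1 + t) * C)) {-3 + t..3 + t}"
      by (rule has_integral_combine[rotated 2]) (use that in auto)
    from has_integral_shift_real_ivl[OF this, of t] show ?thesis
      by simp
  qed
  have "((\<lambda>x. W (x + h) - W (x + 0)) has_integral (J + (1 + h) * C - (J + (1 + 0) * C))) {-3..3}"
    by (intro has_integral_diff shift h) simp
  then have "((\<lambda>x. W (x + h) - W x) has_integral h * C) {-3..3}"
    by (simp add: algebra_simps)
  then show ?thesis
  proof (rule has_integral_on_superset)
    fix x :: real assume "x \<notin> {-3..3}"
    then have "x < -3 \<or> x > 3" by auto
    then show "W (x + h) - W x = 0"
      using h left right by (auto simp: abs_le_iff)
  qed auto
qed

text \<open>The zero extension of a primitive has jumps of height at most \<open>B\<close> at 0 and 1, hence its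
  variation is controlled by the monotone function \<open>W\<close> below, which also counts the jumps.\<close>

lemma zero_extension_shift_le:
  fixes f g F :: "real \<Rightarrow> real"
  assumes g: "g absolutely_integrable_on {0..1}"
    and fF: "negligible {x \<in> {0..1}. f x \<noteq> F x}"
    and F: "\<And>x. x \<in> {0..1} \<Longrightarrow> F x = c + integral {0..x} g"
    and B: "\<And>x. x \<in> {0..1} \<Longrightarrow> \<bar>F x\<bar> \<le> B"
    and p: "1 \<le> p" and h: "\<bar>h\<bar> \<le> 1"
  shows "(LINT x|lebesgue. \<bar>zero_extension f x - zero_extension f (x + h)\<bar> powr p)
    \<le> (2 * B) powr (p - 1) * (\<bar>h\<bar> * (2 * B + integral {0..1} (\<lambda>t. \<bar>g t\<bar>)))"
proof -
  define V where "V x = integral {0..x} (\<lambda>t. \<bar>g t\<bar>)" for x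
  define W where "W x = (if x < 0 then 0 else if x \<le> 1 then B + V x else 2 * B + V 1)" for x
  have B0: "B \<ge> 0" using B[of 0] by auto
  have V: "\<bar>F y - F x\<bar> \<le> V y - V x" if "0 \<le> x" "x \<le> y" "y \<le> 1" for x y
    using indefinite_integral_abs_diff_le[OF g that] that by (simp add: F V_def)
  have V0: "V 0 = 0" by (simp add: V_def)
  have Vmono: "V x \<le> V y" if "0 \<le> x" "x \<le> y" "y \<le> 1" for x y
    using V[OF that] by simp
  let ?F = "zero_extension F"
  have FW: "\<bar>?F y - ?F x\<bar> \<le> W y - W x" if "x \<le> y" for x y
  proof -
    consider "y < 0" | "x < 0" "0 \<le> y" "y \<le> 1" | "x < 0" "1 < y" | "0 \<le> x" "y \<le> 1"
      | "0 \<le> x" "x \<le> 1" "1 < y" | "1 < x"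
      by linarith
    then show ?thesis
    proof cases
      case 2
      then show ?thesis
        using B[of y] Vmono[of 0 y] V0 by (simp add: zero_extension_def W_def)
    next
      case 3
      then show ?thesis
        using Vmono[of 0 1] V0 B0 by (simp add: zero_extension_def W_def)
    next
      case 4
      then show ?thesis
        using V[of x y] that by (simp add: zero_extension_def W_def)
    next
      case 5
      then show ?thesis
        using B[of x] Vmono[of x 1] by (simp add: zero_extension_def W_def)
    qed (use that in \<open>simp_all add: zero_extension_def W_def\<close>)
  qed
  have mono: "W x \<le> W y" if "x \<le> y" for x y
    using FW[OF that] by simp
  define C where "C = 2 * B + V 1"
  have "((\<lambda>x. W (x + h) - W x) has_integral h * C) UNIV"
    by (rule has_integral_shift_diff) (use mono h in \<open>auto simp: W_def C_def\<close>)
  \<comment> \<open>By monotonicity the difference has the sign of \<open>h\<close> throughout, so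
    the integral of its absolute value is known exactly.\<close>
  moreover have "\<bar>W (x + h) - W x\<bar> = (if h \<ge> 0 then 1 else - 1) * (W (x + h) - W x)" for x
    using mono[of x "x + h"] mono[of "x + h" x] by auto
  ultimately have "((\<lambda>x. \<bar>W (x + h) - W x\<bar>) has_integral (if h \<ge> 0 then 1 else - 1) * (h * C)) UNIV"
    by (simp only: has_integral_mult_right)
  then have hW: "((\<lambda>x. \<bar>W (x + h) - W x\<bar>) has_integral \<bar>h\<bar> * C) UNIV"
    by (simp add: abs_if split: if_splits)
  then have "(\<lambda>x. \<bar>W (x + h) - W x\<bar>) absolutely_integrable_on UNIV"
    by (intro nonnegative_absolutely_integrable_1) auto
  then have iW: "integrable lebesgue (\<lambda>x. \<bar>W (x + h) - W x\<bar>)"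
    by (simp add: set_integrable_def)
  have LW: "(LINT x|lebesgue. \<bar>W (x + h) - W x\<bar>) = \<bar>h\<bar> * C"
    using has_integral_unique[OF has_integral_integral_lebesgue[OF iW] hW] .
  let ?N = "{x \<in> {0..1}. f x \<noteq> F x}"
  \<comment> \<open>\<open>f\<close> has to agree with \<open>F\<close> at \<open>x\<close> and at
    \<open>x + h\<close>; the latter can fail only on a translate of the null set.\<close>
  have "negligible ((+) (-h) ` ?N)"
    by (rule negligible_translation[OF fF])
  then have "negligible (?N \<union> (+) (-h) ` ?N)"
    using fF by (rule negligible_Un[rotated])
  then have "AE x in lebesgue. x \<notin> ?N \<union> (+) (-h) ` ?N"
    by (intro AE_not_in) (simp add: negligible_iff_null_sets)
  then have ae: "AE x in lebesgue. \<bar>zero_extension f x - zero_extension f (x + h)\<bar> powr p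
      \<le> (2 * B) powr (p - 1) * \<bar>W (x + h) - W x\<bar>"
  proof eventually_elim
    case (elim x)
    have "x + h \<notin> ?N"
    proof
      assume "x + h \<in> ?N"
      then have "- h + (x + h) \<in> (+) (-h) ` ?N" by (rule imageI)
      then show False using elim by simp
    qed
    then have eq: "zero_extension f x = ?F x" "zero_extension f (x + h) = ?F (x + h)"
      using elim by (auto simp: zero_extension_def)
    have "\<bar>?F y\<bar> \<le> B" for y
      using B[of y] B0 by (simp add: zero_extension_def)
    from this[of x] this[of "x + h"] have "\<bar>?F x - ?F (x + h)\<bar> \<le> 2 * B"
      by linarith
    then have "\<bar>?F x - ?F (x + h)\<bar> powr p \<le> (2 * B) powr (p - 1) * \<bar>?F x - ?F (x + h)\<bar>"
      using p by (intro powr_le_mult_powr) auto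
    also have "\<dots> \<le> (2 * B) powr (p - 1) * \<bar>W (x + h) - W x\<bar>"
    proof (intro mult_left_mono)
      show "\<bar>?F x - ?F (x + h)\<bar> \<le> \<bar>W (x + h) - W x\<bar>"
      proof (cases "0 \<le> h")
        case True
        then show ?thesis using FW[of x "x + h"] by simp
      next
        case False
        then show ?thesis using FW[of "x + h" x] by simp
      qed
    qed simp
    finally show ?case
      unfolding eq .
  qed
  have "(LINT x|lebesgue. \<bar>zero_extension f x - zero_extension f (x + h)\<bar> powr p)
      \<le> (LINT x|lebesgue. (2 * B) powr (p - 1) * \<bar>W (x + h) - W x\<bar>)"
    using ae iW by (intro integral_mono_AE') auto
  also have "\<dots> = (2 * B) powr (p - 1) * (\<bar>h\<bar> * C)"
    by (simp add: LW)
  finally show ?thesis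
    by (simp add: C_def V_def)
qed

section \<open>The L1 bound drawn from an Lp-modulus\<close>

lemma integrable_lebesgue_shift:
  fixes u :: "real \<Rightarrow> real"
  assumes "integrable lebesgue u"
  shows "integrable lebesgue (\<lambda>x. u (x + h))"
    and "(LINT x|lebesgue. u (x + h)) = (LINT x|lebesgue. u x)"
  using lebesgue_integrable_real_affine[OF assms, of 1 h] lebesgue_integral_real_affine[of 1 u h]
  by (simp_all add: add.commute)

lemma integrable_zero_extension_iff:
  "integrable lebesgue (zero_extension u) \<longleftrightarrow> integrable (lebesgue_on {0..1}) u"
proof -
  have "(\<lambda>x. indicator {0..1} x *\<^sub>R u x) = zero_extension u"
    by (auto simp: zero_extension_def indicator_def)
  then show ?thesis
    by (simp add: integrable_restrict_space)
qed

lemma abs_diff_powr_le: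
  fixes a b p :: real
  assumes "0 \<le> p"
  shows "\<bar>a - b\<bar> powr p \<le> 2 powr p * (\<bar>a\<bar> powr p + \<bar>b\<bar> powr p)"
proof -
  let ?m = "max \<bar>a\<bar> \<bar>b\<bar>"
  have "\<bar>a - b\<bar> powr p \<le> (2 * ?m) powr p"
    using assms by (intro powr_mono2) auto
  also have "\<dots> = 2 powr p * ?m powr p"
    by (simp add: powr_mult)
  also have "?m powr p \<le> \<bar>a\<bar> powr p + \<bar>b\<bar> powr p"
    by (simp add: max_def)
  finally show ?thesis by simp
qed

text \<open>On the unit interval the zero extension telescopes into \<open>2 * 2 ^ \<mu> 0\<close>
  translates of the difference \<open>d\<close>, each of L1 norm at most 3; hence the factor
  6.\<close>

lemma Lp_modulus_integral_abs_le:
  assumes mod: "Lp_modulus p g \<mu>" and g: "g \<in> Lp_funs 1" and p: "1 \<le> p"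
  shows "integral {0..1} (\<lambda>x. \<bar>g x\<bar>) \<le> 6 * 2 ^ \<mu> 0"
proof -
  let ?g = "zero_extension g"
  define h :: real where "h = 1 / 2 ^ \<mu> 0"
  have h: "0 < h" "h \<le> 1" by (simp_all add: h_def)
  define d where "d x = ?g x - ?g (x + h)" for x
  have ag: "g absolutely_integrable_on {0..1}"
    by (rule absolutely_integrable_on_if_Lp_funs_1[OF g])
  have ig: "integrable lebesgue ?g"
    using ag by (simp add: integrable_zero_extension_iff absolutely_integrable_imp_integrable)
  have id: "integrable lebesgue d"
    unfolding d_def by (intro Bochner_Integration.integrable_diff ig integrable_lebesgue_shift)
  have "integrable (lebesgue_on {0..1}) (\<lambda>x. \<bar>g x\<bar> powr p)"
    using mod by (simp add: Lp_modulus_def Lp_funs_def)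
  then have "integrable lebesgue (zero_extension (\<lambda>x. \<bar>g x\<bar> powr p))"
    by (simp add: integrable_zero_extension_iff)
  moreover have "zero_extension (\<lambda>x. \<bar>g x\<bar> powr p) = (\<lambda>x. \<bar>?g x\<bar> powr p)"
    by (auto simp: zero_extension_def)
  ultimately have igp: "integrable lebesgue (\<lambda>x. \<bar>?g x\<bar> powr p)"
    by simp
  have idp: "integrable lebesgue (\<lambda>x. \<bar>d x\<bar> powr p)"
  proof (rule Bochner_Integration.integrable_bound)
    show "integrable lebesgue (\<lambda>x. 2 powr p * (\<bar>?g x\<bar> powr p + \<bar>?g (x + h)\<bar> powr p))"
      by (intro integrable_mult_right Bochner_Integration.integrable_add igp
          integrable_lebesgue_shift(1)[where u = "\<lambda>x. \<bar>?g x\<bar> powr p"])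
    show "(\<lambda>x. \<bar>d x\<bar> powr p) \<in> borel_measurable lebesgue"
      using borel_measurable_integrable[OF id] by measurable
    show "AE x in lebesgue. norm (\<bar>d x\<bar> powr p)
        \<le> norm (2 powr p * (\<bar>?g x\<bar> powr p + \<bar>?g (x + h)\<bar> powr p))"
      using abs_diff_powr_le[of p "?g _" "?g _"] p by (intro AE_I2) (simp add: d_def)
  qed
  have "Lp_norm_line p d < 1"
    using mod h unfolding Lp_modulus_def d_def[abs_def]
    by (auto simp: h_def dest!: spec[of _ 0] spec[of _ h])
  moreover have "0 \<le> (LINT x|lebesgue. \<bar>d x\<bar> powr p)"
    by (rule Bochner_Integration.integral_nonneg) simp
  ultimately have dp: "(LINT x|lebesgue. \<bar>d x\<bar> powr p) \<le> 1"
    using p ge_one_powr_ge_zero[of "LINT x|lebesgue. \<bar>d x\<bar> powr p" "1 / p"]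
    by (force simp: Lp_norm_line_def)
  \<comment> \<open>On \<open>{-1..1}\<close>, \<open>\<bar>d x\<bar>\<close> is at most 1 or, as
    \<open>p\<close> is at least 1, at most its \<open>p\<close>-th power; elsewhere
    \<open>d\<close> vanishes because \<open>h\<close> is at most 1. The L1 norm of \<open>d\<close>
    is thus at most 2 + 1.\<close>
  have "\<bar>d x\<bar> \<le> indicator {-1..1} x + \<bar>d x\<bar> powr p" for x
  proof (cases "x \<in> {-1..1}")
    case True
    then show ?thesis
      using powr_mono[of 1 p "\<bar>d x\<bar>"] p by (cases "\<bar>d x\<bar> \<le> 1") (auto intro: add_increasing2)
  next
    case False
    then have "d x = 0" using h by (auto simp: d_def zero_extension_def)
    then show ?thesis by simp
  qed
  then have "(LINT x|lebesgue. \<bar>d x\<bar>) \<le> (LINT x|lebesgue. indicator {-1..1} x + \<bar>d x\<bar> powr p)"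
    using id idp by (intro integral_mono Bochner_Integration.integrable_add) auto
  also have "\<dots> = 2 + (LINT x|lebesgue. \<bar>d x\<bar> powr p)"
    using idp by (subst Bochner_Integration.integral_add) auto
  finally have d3: "(LINT x|lebesgue. \<bar>d x\<bar>) \<le> 3"
    using dp by simp
  \<comment> \<open>The total shift \<open>n * h\<close> is 2, since a shift by 1 would move 0 only
    to the end point 1, where the extension may be nonzero.\<close>
  define n where "n = 2 * (2::nat) ^ \<mu> 0"
  have nh: "real n * h = 2" by (simp add: n_def h_def)
  have ids: "integrable lebesgue (\<lambda>x. \<bar>d (x + real k * h)\<bar>)" for k
    using integrable_lebesgue_shift(1)[OF integrable_abs[OF id]] .
  have "\<bar>?g x\<bar> \<le> (\<Sum>k<n. \<bar>d (x + real k * h)\<bar>)" for x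
  proof (cases "x \<in> {0..1}")
    case True
    have "(\<Sum>k<n. d (x + real k * h)) = ?g x - ?g (x + real n * h)"
      unfolding d_def using sum_lessThan_telescope'[of "\<lambda>k. ?g (x + real k * h)" n]
      by (simp add: algebra_simps)
    also have "?g (x + real n * h) = 0"
      using True by (simp add: nh zero_extension_def)
    finally show ?thesis
      using sum_abs[of "\<lambda>k. d (x + real k * h)" "{..<n}"] by simp
  next
    case False
    then have "?g x = 0" by (auto simp: zero_extension_def)
    then show ?thesis by (simp add: sum_nonneg)
  qed
  then have "(LINT x|lebesgue. \<bar>?g x\<bar>) \<le> (LINT x|lebesgue. (\<Sum>k<n. \<bar>d (x + real k * h)\<bar>))"
    using ig ids by (intro integral_mono Bochner_Integration.integrable_sum) auto
  also have "\<dots> = (\<Sum>k<n. (LINT x|lebesgue. \<bar>d (x + real k * h)\<bar>))"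
    by (rule Bochner_Integration.integral_sum) (rule ids)
  also have "\<dots> = real n * (LINT x|lebesgue. \<bar>d x\<bar>)"
    using integrable_lebesgue_shift(2)[OF integrable_abs[OF id]] by simp
  also have "\<dots> \<le> real n * 3"
    using d3 by (intro mult_left_mono) auto
  finally have le: "(LINT x|lebesgue. \<bar>?g x\<bar>) \<le> 6 * 2 ^ \<mu> 0"
    by (simp add: n_def)
  have "((\<lambda>x. if x \<in> {0..1} then \<bar>g x\<bar> else 0) has_integral (LINT x|lebesgue. \<bar>?g x\<bar>)) UNIV"
    using has_integral_integral_lebesgue[OF integrable_abs[OF ig]]
    by (rule has_integral_eq[rotated]) (simp add: zero_extension_def)
  then have "integral {0..1} (\<lambda>x. \<bar>g x\<bar>) = (LINT x|lebesgue. \<bar>?g x\<bar>)"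
    unfolding has_integral_restrict_UNIV by (rule integral_unique)
  then show ?thesis
    using le by simp
qed

text \<open>Two values of the primitive differ by at most the L1 norm of \<open>g\<close>, so each
  value is within this distance of the mean, which is the integral of \<open>f\<close>.\<close>

lemma primitive_abs_le:
  fixes f g :: "real \<Rightarrow> real"
  assumes g: "g absolutely_integrable_on {0..1}"
    and f: "negligible {x \<in> {0..1}. f x \<noteq> c + integral {0..x} g}" and x: "x \<in> {0..1}"
  shows "\<bar>c + integral {0..x} g\<bar> \<le> \<bar>integral {0..1} f\<bar> + integral {0..1} (\<lambda>t. \<bar>g t\<bar>)"
proof -
  define F where "F y = c + integral {0..y} g" for y
  define V where "V = integral {0..1} (\<lambda>t. \<bar>g t\<bar>)"
  have contF: "continuous_on {0..1} F"
    unfolding F_def using g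
    by (intro continuous_intros indefinite_integral_continuous_1) (auto simp: absolutely_integrable_on_def)
  note iF = integrable_continuous_real[OF contF]
  have "integral {0..1} f = integral {0..1} F"
    by (rule integral_spike[OF f]) (simp add: F_def)
  have diff: "\<bar>F x - F y\<bar> \<le> V" if "y \<in> {0..1}" for y
  proof -
    have le: "\<bar>F v - F u\<bar> \<le> V" if "0 \<le> u" "u \<le> v" "v \<le> 1" for u v
    proof -
      have "\<bar>F v - F u\<bar> \<le> integral {u..v} (\<lambda>t. \<bar>g t\<bar>)"
        using indefinite_integral_diff[OF g that] by (simp add: F_def)
      also have "\<dots> \<le> V"
        unfolding V_def using that indefinite_integral_diff(5)[OF g, of u v] g
        by (intro integral_subset_le) (auto simp: absolutely_integrable_on_def)
      finally show ?thesis .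
    qed
    show ?thesis
      using le[of x y] le[of y x] x that by (cases "x \<le> y") (auto simp: abs_minus_commute)
  qed
  have "F x - integral {0..1} F = integral {0..1} (\<lambda>y. F x - F y)"
    using Henstock_Kurzweil_Integration.integral_diff[OF integrable_const_ivl iF, of "F x"] by simp
  also have "norm \<dots> \<le> integral {0..1} (\<lambda>y::real. V)"
    using diff by (intro integral_norm_bound_integral integrable_diff iF) auto
  finally have "\<bar>F x - integral {0..1} F\<bar> \<le> V"
    by simp
  then show ?thesis
    using \<open>integral {0..1} f = integral {0..1} F\<close> by (simp add: F_def V_def)
qed

text \<open>The \<open>p\<close>-th power of the norm is at most
  \<open>(4 * B) powr p * \<bar>h\<bar>\<close> with \<open>4 * B = 2 ^ (m + 5)\<close>. As
  \<open>\<nu> n\<close> is at least \<open>p * (n + m + 7)\<close>, at most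
  \<open>2 powr (- (n + 2) * p)\<close> is left, and its \<open>p\<close>-th root is below
  \<open>1 / 2 ^ n\<close>.\<close>

lemma Lp_modulus_if_weak_derivative:
  assumes p: "1 \<le> p" and f: "f \<in> Lp_funs p" and fg: "weak_derivative f g"
    and mod: "Lp_modulus p g \<mu>" "\<mu> 0 \<le> m" and mean: "\<bar>integral {0..1} f\<bar> \<le> 2 ^ m + 1"
    and k: "p \<le> real k" and \<nu>: "\<And>n. k * (n + m + 7) \<le> \<nu> n" "\<And>n. \<nu> n < \<nu> (Suc n)"
  shows "Lp_modulus p f \<nu>"
  unfolding Lp_modulus_def
proof (intro conjI allI impI f \<nu>(2))
  fix n and h :: real assume h: "\<bar>h\<bar> \<le> 1 / 2 ^ \<nu> n"
  have g1: "g \<in> Lp_funs 1"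
    using fg by (simp add: weak_derivative_def)
  note g = absolutely_integrable_on_if_Lp_funs_1[OF g1]
  define V where "V = integral {0..1} (\<lambda>x. \<bar>g x\<bar>)"
  \<comment> \<open>\<open>B = 8 * 2 ^ m\<close> dominates \<open>2 ^ m + 1\<close>, the bound for
    the mean, plus \<open>6 * 2 ^ m\<close>, the bound for the L1 norm of \<open>g\<close>.\<close>
  define B :: real where "B = 2 ^ (m + 3)"
  have "(2::real) ^ \<mu> 0 \<le> 2 ^ m"
    using mod(2) by (intro power_increasing) auto
  then have V: "V \<le> 6 * 2 ^ m"
    using Lp_modulus_integral_abs_le[OF mod(1) g1 p] unfolding V_def by linarith
  have one: "(1::real) \<le> 2 ^ m" by simp
  obtain c where c: "negligible {x \<in> {0..1}. f x \<noteq> c + integral {0..x} g}"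
    using weak_derivative_primitive[OF fg] .
  have B: "\<bar>c + integral {0..x} g\<bar> \<le> B" if "x \<in> {0..1}" for x
  proof -
    have "B = 8 * 2 ^ m" by (simp add: B_def power_add)
    then show ?thesis
      using primitive_abs_le[OF g c that] V mean one unfolding V_def[symmetric] by linarith
  qed
  have "(1::real) / 2 ^ \<nu> n \<le> 1" by simp
  then have h1: "\<bar>h\<bar> \<le> 1" using h by linarith
  define I where "I = (LINT x|lebesgue. \<bar>zero_extension f x - zero_extension f (x + h)\<bar> powr p)"
  have "I \<le> (2 * B) powr (p - 1) * (\<bar>h\<bar> * (2 * B + V))"
    unfolding I_def V_def by (rule zero_extension_shift_le[OF g c _ B p h1]) auto
  \<comment> \<open>Both \<open>2 * B\<close> and \<open>2 * B + V\<close> are enlarged to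
    \<open>4 * B\<close>, so that the factors merge into one power.\<close>
  also have "\<dots> \<le> (4 * B) powr (p - 1) * (\<bar>h\<bar> * (4 * B))"
  proof -
    have "B = 8 * 2 ^ m" by (simp add: B_def power_add)
    moreover have "0 \<le> V"
      unfolding V_def using g by (intro integral_nonneg) (auto simp: absolutely_integrable_on_def)
    ultimately have "0 \<le> B" "V \<le> 2 * B" "0 \<le> V"
      using V one by linarith+
    then show ?thesis
      using p by (intro mult_mono powr_mono2 mult_left_mono) auto
  qed
  also have "\<dots> = (4 * B) powr p * \<bar>h\<bar>"
    using powr_add[of "4 * B" "p - 1" 1] by (simp add: B_def)
  also have "4 * B = 2 powr real (m + 5)"
    by (subst powr_realpow) (simp_all add: B_def power_add)
  also have "(2 powr real (m + 5)) powr p * \<bar>h\<bar> \<le> 2 powr (real (m + 5) * p) * 2 powr - (p * real (n + m + 7))"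
  proof -
    have "\<bar>h\<bar> \<le> 2 powr - real (\<nu> n)"
      using h by (simp add: powr_minus powr_realpow divide_inverse)
    also have "\<dots> \<le> 2 powr - (p * real (n + m + 7))"
    proof (intro powr_mono)
      have "p * real (n + m + 7) \<le> real k * real (n + m + 7)"
        using k by (intro mult_right_mono) auto
      also have "\<dots> \<le> real (\<nu> n)"
        using \<nu>(1)[of n] by (metis of_nat_le_iff of_nat_mult)
      finally show "- real (\<nu> n) \<le> - (p * real (n + m + 7))" by simp
    qed simp
    finally show ?thesis
      by (intro mult_mono) (auto simp: powr_powr)
  qed
  also have "\<dots> = 2 powr (- (real (n + 2)) * p)"
    by (simp add: powr_add[symmetric] algebra_simps)
  finally have I: "I \<le> 2 powr (- (real (n + 2)) * p)" .
  have "Lp_norm_line p (\<lambda>x. zero_extension f x - zero_extension f (x + h)) = I powr (1 / p)"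
    by (simp add: Lp_norm_line_def I_def)
  also have "\<dots> \<le> (2 powr (- (real (n + 2)) * p)) powr (1 / p)"
    using I p by (intro powr_mono2) (auto simp: I_def)
  also have "\<dots> = 2 powr (- real (n + 2))"
    using p by (simp add: powr_powr)
  also have "\<dots> < 2 powr (- real n)"
    by (intro powr_less_mono) auto
  also have "\<dots> = 1 / 2 ^ n"
    by (simp add: powr_minus powr_realpow divide_inverse)
  finally show "Lp_norm_line p (\<lambda>x. zero_extension f x - zero_extension f (x + h)) < 1 / 2 ^ n" .
qed

section \<open>Names padded with zeros\<close>

lemma interval_integral_lebesgue_eq_integral:
  fixes f :: "real \<Rightarrow> real"
  assumes "f absolutely_integrable_on {a..b}" "a \<le> b"
  shows "(LINT x=ereal a..ereal b|lebesgue. f x) = integral {a..b} f"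
proof -
  have "f absolutely_integrable_on {a<..<b}"
    using assms absolutely_integrable_on_open_interval[of a b f] by (simp add: box_real)
  from set_lebesgue_integral_eq_integral(2)[OF this] assms(2) show ?thesis
    by (simp add: interval_lebesgue_integral_def integral_open_interval_real)
qed

lemma Lp_space_member:
  assumes "F \<in> Lp_space p" "f \<in> F"
  shows "f \<in> Lp_funs p"
  using assms by (auto simp: Lp_space_def quotient_def ae_eq_def)

text \<open>\<open>m\<close> absorbs the constant \<open>7 * k\<close> and is at least the length of
  the query for the integral over the whole interval. The padding contains the size at
  \<open>length a + m\<close> because this bounds the length of that answer, whatever
  \<open>a\<close> is.\<close>

lemma padded_name:
  fixes \<phi> :: strfun
  assumes p: "1 \<le> p" "p \<le> real k" and name: "xi pr 1 p \<phi> F"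
    and m: "7 * k \<le> m" "length (triple pr [] [False, True, False, True] (ones 0)) \<le> m"
  defines "\<psi> \<equiv> \<lambda>a. \<phi> a @
    replicate (m + 2 * k * length a + 2 * k * fun_size \<phi> (length a + m)) False"
  shows "xi pr 0 p \<psi> F"
proof -
  let ?l = "fun_size \<phi>"
  from name obtain f g where F: "F \<in> sobolev_space 1 p" "f \<in> F" and lm: "length_monotone \<phi>"
    and int: "\<And>a b n. dyadic a \<in> {0..1} \<Longrightarrow> dyadic b \<in> {0..1} \<Longrightarrow>
        \<bar>(LINT x=ereal (dyadic a)..ereal (dyadic b)|lebesgue. f x)
          - dyadic (\<phi> (triple pr a b (ones n)))\<bar> < 1 / 2 ^ n"
    and pow: "(weak_derivative ^^ 1) f g" and mod: "Lp_modulus p g ?l"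
    unfolding xi_def by blast
  have fg: "weak_derivative f g"
    using pow by (simp add: eq_OO)
  have FLp: "F \<in> Lp_space p"
    using F by (simp add: sobolev_space_def)
  then have f: "f \<in> Lp_funs p"
    using F(2) Lp_space_member by blast
  note len = length_eq_fun_size[OF lm] and lmono = fun_size_mono[OF lm]
  have size: "length (\<psi> a) =
      ?l (length a) + m + 2 * k * length a + 2 * k * ?l (length a + m)" for a
    by (simp add: \<psi>_def len)
  have "f absolutely_integrable_on {0..1}"
    using fg absolutely_integrable_on_if_Lp_funs_1 by (simp add: weak_derivative_def)
  then have mean_eq: "(LINT x=ereal 0..ereal 1|lebesgue. f x) = integral {0..1} f"
    by (rule interval_integral_lebesgue_eq_integral) simp
  \<comment> \<open>The codes stand for 0 and 1. Precision index 0 means an error below 1, the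
    source of the summand 1 in the bound for the mean.\<close>
  define d where "d = \<phi> (triple pr [] [False, True, False, True] (ones 0))"
  have "\<bar>(LINT x=ereal 0..ereal 1|lebesgue. f x) - dyadic d\<bar> < 1"
    using int[of "[]" "[False, True, False, True]" 0] unfolding dyadic_one d_def by simp
  moreover have "\<bar>dyadic d\<bar> \<le> 2 ^ ?l m"
  proof -
    have "length d \<le> ?l m"
      using m(2) lmono by (simp add: d_def len)
    then have "(2::real) ^ length d \<le> 2 ^ ?l m"
      by (intro power_increasing) auto
    then show ?thesis
      using abs_dyadic_le[of d] by linarith
  qed
  ultimately have mean: "\<bar>integral {0..1} f\<bar> \<le> 2 ^ ?l m + 1"
    unfolding mean_eq by linarith
  have k: "1 \<le> k"
    using p by linarith
  have modf: "Lp_modulus p f (fun_size \<psi>)"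
  proof (rule Lp_modulus_if_weak_derivative[OF p(1) f fg mod _ mean p(2)])
    show "?l 0 \<le> ?l m"
      by (rule lmono) simp
    fix n
    have \<psi>: "fun_size \<psi> j = ?l j + m + 2 * k * j + 2 * k * ?l (j + m)" for j
      using size[of "ones j"] by (simp add: fun_size_def[of \<psi>] ones_def)
    have "k * (n + ?l m + 7) = k * n + k * ?l m + 7 * k"
      by (simp add: algebra_simps)
    \<comment> \<open>Summand by summand, using that \<open>?l m\<close> is at most
      \<open>?l (n + m)\<close> and \<open>7 * k\<close> at most \<open>m\<close>.\<close>
    also have "\<dots> \<le> 2 * k * n + 2 * k * ?l (n + m) + m"
      using m(1) lmono[of m "n + m"] by (intro add_mono mult_le_mono) auto
    finally show "k * (n + ?l m + 7) \<le> fun_size \<psi> n"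
      by (simp add: \<psi>)
    \<comment> \<open>Strict growth comes from the sweeps over the input, as the size of the name
      need only be weakly monotone.\<close>
    have "2 * k * n < 2 * k * Suc n"
      using k by simp
    moreover have "?l n \<le> ?l (Suc n)" "2 * k * ?l (n + m) \<le> 2 * k * ?l (Suc n + m)"
      by (intro lmono mult_le_mono; simp)+
    ultimately show "fun_size \<psi> n < fun_size \<psi> (Suc n)"
      unfolding \<psi> by linarith
  qed
  have "length_monotone \<psi>"
    unfolding length_monotone_def size
    by (intro allI impI add_mono mult_le_mono lmono) auto
  moreover have "dyadic (\<psi> w) = dyadic (\<phi> w)" for w
    unfolding \<psi>_def by (rule dyadic_append_zeros)
  moreover have "F \<in> sobolev_space 0 p"
    using FLp F(2) by (auto simp: sobolev_space_def)
  ultimately show ?thesis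
    unfolding xi_def using F(2) int modf by (intro conjI bexI[of _ f]) auto
qed

theorem theorem4p4:
  fixes p :: real and pr :: "str \<Rightarrow> str \<Rightarrow> str"
  assumes "1 \<le> p"
    and "pairing_function pr"
  shows "polytime_computable_map (sobolev_space 1 p) (xi pr 1 p) (Lp_space p) (xi pr 0 p) (\<lambda>F. F)"
proof -
  obtain k :: nat where k: "p \<le> real k"
    using real_arch_simple by blast
  \<comment> \<open>\<open>k\<close> and \<open>m\<close> depend on \<open>p\<close> and the pairing
    only, so one machine and one second-order polynomial serve all names.\<close>
  define m where "m = max (7 * k) (length (triple pr [] [False, True, False, True] (ones 0)))"
  define P where "P l n = 4 * k + 2 * m + 11 + (2 * k + 2) * n + l n + 2 * k * l (n + m)" for l n
  have "second_order_poly P"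
    unfolding P_def using second_order_poly_pad_time[of k m] by simp
  moreover have "\<exists>\<psi>. xi pr 0 p \<psi> F \<and>
      (\<forall>a. computes_within (compile (pad_program k m)) \<phi> [a] (\<psi> a) (P (fun_size \<phi>) (length a)))"
    if name: "xi pr 1 p \<phi> F" for \<phi> F
  proof -
    have "length_monotone \<phi>"
      using name by (simp add: xi_def)
    from pad_program_computes[OF this, of k m] padded_name[OF assms(1) k name, of m]
    show ?thesis
      unfolding P_def m_def by (intro exI conjI allI) (assumption | simp)+
  qed
  moreover have "\<forall>F\<in>sobolev_space 1 p. F \<in> Lp_space p"
    by (simp add: sobolev_space_def)
  ultimately show ?thesis
    unfolding polytime_computable_map_def using wf_machine_compile by blast
qed

end
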